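(* Let $P\subseteq\mathbb{R}^d$ be a full-dimensional simple convex polytope with $n$ facets, let $\Sigma=\Sigma_P$ be its normal fan, and let $U\in\mathbb{R}^{n\times d}$ be a ray matrix of $\Sigma$. Then $\mathcal{A}_P=\{x\in\mathbb{P}^{n-1}:{\rm Adj}_P(x)=0\}$ is the unique hypersurface $X\subset\mathbb{P}^{n-1}$ of degree $n-d$ satisfying the following two properties: 1. $[\Lambda_J]\in F_{n-1-|J|}(X)$ for each primitive collection $J\in\Sigma^c$, and 2. $[\Lambda_e\cap H_e]\in F_{n-d-1}(X)$ for each edge $e$ of $P$.
   Context: The normal fan $\Sigma_P$ is the inner normal fan; its rays are in bijection with the facets of $P$, and its $d$-dimensional cones $\sigma_v$ with the vertices $v$ of $P$. It is simplicial because $P$ is simple. A ray matrix $U$ has rows $u_Q$ indexed by facets $Q$ of $P$, each $u_Q$ a nonzero generator of the ray of $\Sigma_P$ corresponding to $Q$; $U_\sigma$ is the submatrix with rows indexed by the rays $\sigma(1)$ of $\sigma$. $\mathbb{P}^{n-1}$ is complex projective space with homogeneous coordinates $x_Q$, $Q$ ranging over the facets of $P$. The universal adjoint of $P$ (depending on $U$) is, with $\Sigma(d)$ the set of $d$-dimensional cones of $\Sigma$, $${\rm Adj}_P(x)=\sum_{\sigma\in\Sigma(d)}|\det U_\sigma|\prod_{Q\notin\sigma(1)}x_Q,$$ where rays and facets are identified. A hypersurface of degree $n-d$ is $X=\{x\in\mathbb{P}^{n-1}:f(x)=0\}$ with $f\ne 0$ a homogeneous polynomial of degree $n-d$, taken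 up to scaling. $F_k(X)=\{[\Lambda]\in{\rm Gr}(k+1,n):\Lambda\subseteq X\}$ is (the underlying set of) the Fano scheme of $k$-planes in $X$; here $[\Lambda]$ is the point of the Grassmannian of a $k$-dimensional linear subspace $\Lambda\subseteq\mathbb{P}^{n-1}$ (for $k=-1$, $\Lambda=\emptyset$ and the condition is void). $\Sigma^c$ is the set of subsets $J$ of the set of facets of $P$ with $\bigcap_{Q\in J}Q=\emptyset$ (equivalently, the corresponding rays are not contained in a common cone of $\Sigma$); primitive collections are the inclusion-minimal elements of $\Sigma^c$. $\Lambda_J=\{x\in\mathbb{P}^{n-1}:x_Q=0\text{ for all }Q\in J\}$. For an edge $e$ of $P$, $\Lambda_e=\{x\in\mathbb{P}^{n-1}:x_Q=0\text{ for all facets }Q\supseteq e\}$, of dimension $n-d$. Let $Q_e^1,Q_e^2$ be the two facets of $P$ which do not contain $e$ but intersect $e$ in its vertices $v_e^1$ and $v_e^2$, respectively. With $u_v=|\det U_{\sigma_v}|$, $$H_e=\{x\in\mathbb{P}^{n-1}:u_{v_e^1}\,x_{Q_e^2}+u_{v_e^2}\,x_{Q_e^1}=0\}.$$ *)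

theory Defs
  imports "HOL-Analysis.Analysis" "HOL-Library.Poly_Mapping"
begin

text \<open>
  Throughout, the finite type \<open>'n\<close> labels the facets of \<open>P\<close>: the labelling
  \<open>Q :: 'n \<Rightarrow> (real^'d) set\<close> is assumed to be a bijection onto the set of facets, so
  \<open>CARD('n)\<close> is the number of facets, sets of facets (or rays) are sets of labels, and rows of
  ray matrices and homogeneous coordinates are indexed by \<open>'n\<close>.
\<close>

subsection \<open>Simple polytopes and their normal fans\<close>

definition simple_polytope :: "(real^'d) set \<Rightarrow> bool" where
  "simple_polytope P \<longleftrightarrow>
     polytope P \<and> aff_dim P = int CARD('d) \<and>
     (\<forall>v. v extreme_point_of P \<longrightarrow> card {F. F facet_of P \<and> v \<in> F} = CARD('d))"

definition facet_labelling :: "(real^'d) set \<Rightarrow> ('n \<Rightarrow> (real^'d) set) \<Rightarrow> bool" where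
  "facet_labelling P Q \<longleftrightarrow> bij_betw Q UNIV {F. F facet_of P}"

text \<open>Inner normal cone: the functionals whose minimum over \<open>P\<close> is attained on all of \<open>F\<close>.\<close>

definition normal_cone :: "(real^'d) set \<Rightarrow> (real^'d) set \<Rightarrow> (real^'d) set" where
  "normal_cone P F = {u. \<forall>x\<in>F. \<forall>y\<in>P. u \<bullet> x \<le> u \<bullet> y}"

definition normal_fan :: "(real^'d) set \<Rightarrow> (real^'d) set set" where
  "normal_fan P = {normal_cone P F | F. F face_of P \<and> F \<noteq> {}}"

definition fan_cones :: "(real^'d) set set \<Rightarrow> nat \<Rightarrow> (real^'d) set set" where
  "fan_cones \<Sigma> k = {\<sigma> \<in> \<Sigma>. aff_dim \<sigma> = int k}"

text \<open>The rays \<open>\<sigma>(1)\<close>, with a ray identified with the label of the corresponding facet.\<close>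

definition cone_rays ::
    "(real^'d) set \<Rightarrow> ('n \<Rightarrow> (real^'d) set) \<Rightarrow> (real^'d) set \<Rightarrow> 'n set" where
  "cone_rays P Q \<sigma> =
     {i. normal_cone P (Q i) \<in> fan_cones (normal_fan P) 1 \<and> normal_cone P (Q i) face_of \<sigma>}"

definition ray_matrix ::
    "(real^'d) set \<Rightarrow> ('n \<Rightarrow> (real^'d) set) \<Rightarrow> real^'d^'n \<Rightarrow> bool" where
  "ray_matrix P Q U \<longleftrightarrow>
     (\<forall>i. U $ i \<noteq> 0 \<and> normal_cone P (Q i) = {t *\<^sub>R (U $ i) | t. t \<ge> 0})"

text \<open>
  \<open>|det U\<^sub>I|\<close> for the square submatrix with rows \<open>I\<close>, where \<open>card I = CARD('d)\<close>.
  The absolute value does not depend on the chosen ordering \<open>b\<close> of the rows.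
\<close>

definition abs_det_rows :: "real^'d^'n \<Rightarrow> 'n set \<Rightarrow> real" where
  "abs_det_rows U I =
     (let b = (SOME b. bij_betw b (UNIV :: 'd set) I) in \<bar>det ((\<chi> i. U $ b i) :: real^'d^'d)\<bar>)"

subsection \<open>Complex polynomials in variables indexed by a finite type\<close>

type_synonym 'n cpoly = "('n \<Rightarrow>\<^sub>0 nat) \<Rightarrow>\<^sub>0 complex"

definition pconst :: "complex \<Rightarrow> 'n cpoly" where
  "pconst c = Poly_Mapping.single 0 c"

definition pvar :: "'n \<Rightarrow> 'n cpoly" where
  "pvar i = Poly_Mapping.single (Poly_Mapping.single i 1) 1"

definition peval :: "'n::finite cpoly \<Rightarrow> complex^'n \<Rightarrow> complex" where
  "peval f x =
     (\<Sum>m\<in>Poly_Mapping.keys f.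
        Poly_Mapping.lookup f m * (\<Prod>i\<in>UNIV. (x $ i) ^ Poly_Mapping.lookup m i))"

definition homogeneous :: "nat \<Rightarrow> 'n::finite cpoly \<Rightarrow> bool" where
  "homogeneous k f \<longleftrightarrow>
     (\<forall>m\<in>Poly_Mapping.keys f. (\<Sum>i\<in>UNIV. Poly_Mapping.lookup m i) = k)"

definition universal_adjoint ::
    "(real^'d) set \<Rightarrow> ('n::finite \<Rightarrow> (real^'d) set) \<Rightarrow> real^'d^'n \<Rightarrow> 'n cpoly" where
  "universal_adjoint P Q U =
     (\<Sum>\<sigma>\<in>fan_cones (normal_fan P) CARD('d).
        pconst (of_real (abs_det_rows U (cone_rays P Q \<sigma>))) *
        (\<Prod>i\<in>- cone_rays P Q \<sigma>. pvar i))"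

subsection \<open>Projective space, linear subspaces, and Fano schemes\<close>

text \<open>
  Points of \<open>\<P>\<^sup>n\<^sup>-\<^sup>1\<close> are the one-dimensional linear subspaces \<open>L\<close> of \<open>\<complex>\<^sup>n\<close>. A homogeneous condition
  holds at \<open>L\<close> if it holds for all vectors of \<open>L\<close>. Note that \<open>vec.dim\<close> is the dimension over
  the complex numbers.
\<close>

definition proj_space :: "(complex^'n) set set" where
  "proj_space = {L. vec.subspace L \<and> vec.dim L = 1}"

definition proj_zeros :: "'n::finite cpoly \<Rightarrow> (complex^'n) set set" where
  "proj_zeros f = {L \<in> proj_space. \<forall>x\<in>L. peval f x = 0}"

text \<open>
  A \<open>k\<close>-plane is the point set of the projectivization of a linear subspace of dimension \<open>k + 1\<close>;
  it stands for the corresponding point of \<open>Gr(k+1,n)\<close>. The only \<open>-1\<close>-plane is empty.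
\<close>

definition proj_planes :: "int \<Rightarrow> (complex^'n) set set set" where
  "proj_planes k =
     {{L \<in> proj_space. L \<subseteq> W} | W. vec.subspace W \<and> int (vec.dim W) = k + 1}"

definition fano :: "int \<Rightarrow> (complex^'n) set set \<Rightarrow> (complex^'n) set set set" where
  "fano k X = {\<Lambda> \<in> proj_planes k. \<Lambda> \<subseteq> X}"

definition coord_plane :: "'n set \<Rightarrow> (complex^'n) set set" where
  "coord_plane J = {L \<in> proj_space. \<forall>x\<in>L. \<forall>i\<in>J. x $ i = 0}"

subsection \<open>Primitive collections and edges\<close>

definition noncones :: "('n \<Rightarrow> (real^'d) set) \<Rightarrow> 'n set set" where
  "noncones Q = {J. (\<Inter>i\<in>J. Q i) = {}}"

definition primitive_collection :: "('n \<Rightarrow> (real^'d) set) \<Rightarrow> 'n set \<Rightarrow> bool" where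
  "primitive_collection Q J \<longleftrightarrow> J \<in> noncones Q \<and> (\<forall>J'. J' \<subset> J \<longrightarrow> J' \<notin> noncones Q)"

text \<open>The facet that does not contain the edge \<open>e\<close> but meets it in its vertex \<open>v\<close>.\<close>

definition end_facet :: "('n \<Rightarrow> (real^'d) set) \<Rightarrow> (real^'d) set \<Rightarrow> real^'d \<Rightarrow> 'n" where
  "end_facet Q e v = (THE i. \<not> e \<subseteq> Q i \<and> e \<inter> Q i = {v})"

definition vertex_weight ::
    "(real^'d) set \<Rightarrow> ('n \<Rightarrow> (real^'d) set) \<Rightarrow> real^'d^'n \<Rightarrow> real^'d \<Rightarrow> real" where
  "vertex_weight P Q U v = abs_det_rows U (cone_rays P Q (normal_cone P {v}))"

definition edge_plane :: "('n \<Rightarrow> (real^'d) set) \<Rightarrow> (real^'d) set \<Rightarrow> (complex^'n) set set" where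
  "edge_plane Q e = coord_plane {i. e \<subseteq> Q i}"

text \<open>The hyperplane \<open>H\<^sub>e\<close> of the edge \<open>e\<close> with vertices \<open>v\<close> and \<open>w\<close>; it is symmetric in \<open>v\<close> and \<open>w\<close>.\<close>

definition edge_hyperplane ::
    "(real^'d) set \<Rightarrow> ('n \<Rightarrow> (real^'d) set) \<Rightarrow> real^'d^'n \<Rightarrow>
     (real^'d) set \<Rightarrow> real^'d \<Rightarrow> real^'d \<Rightarrow> (complex^'n) set set" where
  "edge_hyperplane P Q U e v w =
     {L \<in> proj_space. \<forall>x\<in>L.
        of_real (vertex_weight P Q U v) * x $ end_facet Q e w +
        of_real (vertex_weight P Q U w) * x $ end_facet Q e v = 0}"

definition contains_primitive_planes ::
    "('n \<Rightarrow> (real^'d) set) \<Rightarrow> (complex^'n) set set \<Rightarrow> bool" where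
  "contains_primitive_planes Q X \<longleftrightarrow>
     (\<forall>J. primitive_collection Q J \<longrightarrow>
        coord_plane J \<in> fano (int CARD('n) - 1 - int (card J)) X)"

definition contains_edge_planes ::
    "(real^'d) set \<Rightarrow> ('n \<Rightarrow> (real^'d) set) \<Rightarrow> real^'d^'n \<Rightarrow> (complex^'n) set set \<Rightarrow> bool" where
  "contains_edge_planes P Q U X \<longleftrightarrow>
     (\<forall>e v w. e edge_of P \<and> v \<noteq> w \<and> {z. z extreme_point_of e} = {v, w} \<longrightarrow>
        edge_plane Q e \<inter> edge_hyperplane P Q U e v w
          \<in> fano (int CARD('n) - int CARD('d) - 1) X)"

end

theory Submission
  imports Defs
begin

text \<open>
  Write \<open>I\<^sub>v\<close> for the set of facets through a vertex \<open>v\<close>. Vanishing on the planes of the primitive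
  collections means that every monomial of \<open>f\<close> omits only variables whose facets have a common
  point, hence only variables in some \<open>I\<^sub>v\<close>; as the degree is \<open>n - d\<close>, \<open>f\<close> is a combination
  \<open>\<Sum>\<^sub>v c\<^sub>v \<Prod>\<^bsub>i \<notin> I\<^sub>v\<^esub> x\<^sub>i\<close> over the vertices. Restricted to the plane of an edge with ends \<open>v\<close>, \<open>w\<close>
  only the terms of \<open>v\<close> and \<open>w\<close> survive, so vanishing on the hyperplane section says
  \<open>c\<^sub>v u\<^sub>w = c\<^sub>w u\<^sub>v\<close>. The weights \<open>u\<^sub>v\<close> are nonzero and the graph of \<open>P\<close> is connected (simplex method),
  so \<open>c\<close> is proportional to \<open>u\<close>.
\<close>

subsection \<open>Polynomials and planes\<close>

lemma peval_superset:
  assumes "finite K" "Poly_Mapping.keys f \<subseteq> K"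
  shows "peval f x =
    (\<Sum>m\<in>K. Poly_Mapping.lookup f m * (\<Prod>i\<in>UNIV. (x $ i) ^ Poly_Mapping.lookup m i))"
  unfolding peval_def
  by (rule sum.mono_neutral_left) (use assms in \<open>auto simp: in_keys_iff\<close>)

lemma peval_add: "peval (f + g) x = peval f x + peval g x"
proof -
  let ?K = "Poly_Mapping.keys f \<union> Poly_Mapping.keys g"
  show ?thesis
    using keys_add[of f g]
    by (simp add: peval_superset[of ?K] lookup_add distrib_right sum.distrib)
qed

lemma peval_zero [simp]: "peval 0 x = 0"
  by (simp add: peval_def)

lemma peval_sum: "peval (sum f A) x = (\<Sum>a\<in>A. peval (f a) x)"
  by (induction A rule: infinite_finite_induct) (auto simp: peval_add)

lemma peval_single:
  "peval (Poly_Mapping.single m c) x = c * (\<Prod>i\<in>UNIV. (x $ i) ^ Poly_Mapping.lookup m i)"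
  by (simp add: peval_def)

text \<open>Points of projective space are lines, so a plane without points says nothing about the
  origin. In positive degree every monomial contains a variable, which supplies the vanishing
  there.\<close>

lemma peval_at_0:
  assumes "homogeneous k f" "k > 0"
  shows "peval f 0 = 0"
  unfolding peval_def
proof (rule sum.neutral, rule ballI)
  fix m assume m: "m \<in> Poly_Mapping.keys f"
  have "\<exists>i. Poly_Mapping.lookup m i \<noteq> 0"
  proof (rule ccontr)
    assume "\<nexists>i. Poly_Mapping.lookup m i \<noteq> 0"
    then show False using assms m by (force simp: homogeneous_def)
  qed
  then obtain i where "Poly_Mapping.lookup m i \<noteq> 0" ..
  then have "(\<Prod>i\<in>UNIV. (0 $ i :: complex) ^ Poly_Mapping.lookup m i) = 0"
    by (intro prod_zero) auto
  then show "Poly_Mapping.lookup f m * (\<Prod>i\<in>UNIV. (0 $ i) ^ Poly_Mapping.lookup m i) = 0"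
    by simp
qed

text \<open>Induction on the set of variables. With the other variables fixed, the sum is a
  polynomial in the new one and so has zero coefficients. Each coefficient is again such a sum, over
  the monomials with one fixed exponent of the new variable; these are still told apart by the
  remaining exponents.\<close>

lemma monomials_independent:
  fixes a :: "'m \<Rightarrow> complex" and e :: "'m \<Rightarrow> 'i \<Rightarrow> nat"
  assumes "finite A" "finite K"
    and "\<And>m m'. m \<in> K \<Longrightarrow> m' \<in> K \<Longrightarrow> (\<And>i. i \<in> A \<Longrightarrow> e m i = e m' i) \<Longrightarrow> m = m'"
    and "\<And>x. (\<Sum>m\<in>K. a m * (\<Prod>i\<in>A. x i ^ e m i)) = 0"
    and "m \<in> K"
  shows "a m = 0"
  using assms
proof (induction A arbitrary: K rule: finite_induct)
  case empty
  then have "K = {m}" by blast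
  then show ?case using empty(3) by simp
next
  case (insert j A)
  \<comment> \<open>A degree bound in variable \<open>j\<close>, so that the sum can be sorted by
    powers of that variable.\<close>
  define N where "N = Max ((\<lambda>m. e m j) ` K)"
  have N: "e m' j \<le> N" if "m' \<in> K" for m'
    using that insert.prems(1) by (auto simp: N_def)
  let ?K = "\<lambda>k. {m' \<in> K. e m' j = k}"
  have "(\<Sum>m'\<in>?K k. a m' * (\<Prod>i\<in>A. x i ^ e m' i)) = 0" if k: "k \<le> N" for x :: "'i \<Rightarrow> complex" and k
  proof -
    define c where "c k = (\<Sum>m'\<in>?K k. a m' * (\<Prod>i\<in>A. x i ^ e m' i))" for k
    have "(\<Sum>k\<le>N. c k * t ^ k) = 0" for t
    proof -
      have "(\<Prod>i\<in>A. (x(j := t)) i ^ e m' i) = (\<Prod>i\<in>A. x i ^ e m' i)" for m'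
        by (rule prod.cong) (use insert.hyps in auto)
      then have "0 = (\<Sum>m'\<in>K. a m' * (\<Prod>i\<in>A. x i ^ e m' i) * t ^ e m' j)"
        using insert.prems(3)[of "x(j := t)"] insert.hyps by (simp add: mult_ac)
      also have "\<dots> = (\<Sum>k\<le>N. \<Sum>m'\<in>?K k. a m' * (\<Prod>i\<in>A. x i ^ e m' i) * t ^ e m' j)"
        by (rule sum.group[symmetric]) (use insert.prems(1) N in auto)
      finally show ?thesis by (simp add: c_def sum_distrib_right)
    qed
    then have "c k = 0" using polyfun_eq_0[of c N] k by blast
    then show ?thesis by (simp only: c_def)
  qed
  then have zero: "(\<Sum>m'\<in>?K (e m j). a m' * (\<Prod>i\<in>A. x i ^ e m' i)) = 0" for x
    using N insert.prems(4) by blast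
  have inj: "m1 = m2"
    if "m1 \<in> ?K (e m j)" "m2 \<in> ?K (e m j)" "\<And>i. i \<in> A \<Longrightarrow> e m1 i = e m2 i" for m1 m2
    by (rule insert.prems(2)) (use that in auto)
  have "finite (?K (e m j))" "m \<in> ?K (e m j)" using insert.prems(1,4) by auto
  from insert.IH[OF this(1) inj zero this(2)] show ?case .
qed

text \<open>Setting the variables of \<open>J\<close> to zero kills every monomial that involves one
  of them. The surviving monomials stay distinct in the other variables, so independence applies to
  them.\<close>

lemma coefficient_eq_0:
  fixes f :: "'n::finite cpoly"
  assumes vanish: "\<And>x. (\<And>i. i \<in> J \<Longrightarrow> x $ i = 0) \<Longrightarrow> peval f x = 0"
    and m: "\<And>i. i \<in> J \<Longrightarrow> Poly_Mapping.lookup m i = 0"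
  shows "Poly_Mapping.lookup f m = 0"
proof (rule ccontr)
  assume nz: "Poly_Mapping.lookup f m \<noteq> 0"
  define K where "K = {m \<in> Poly_Mapping.keys f. \<forall>i\<in>J. Poly_Mapping.lookup m i = 0}"
  have "Poly_Mapping.lookup f m = 0"
  proof (rule monomials_independent[of "- J" K Poly_Mapping.lookup "Poly_Mapping.lookup f" m])
    show "m \<in> K" using nz m by (simp add: K_def in_keys_iff)
    show "m1 = m2" if "m1 \<in> K" "m2 \<in> K"
      "\<And>i. i \<in> - J \<Longrightarrow> Poly_Mapping.lookup m1 i = Poly_Mapping.lookup m2 i" for m1 m2
      by (rule poly_mapping_eqI) (use that in \<open>metis (mono_tags, lifting) ComplI K_def mem_Collect_eq\<close>)
  next
    fix x :: "'n \<Rightarrow> complex"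
    define y :: "complex^'n" where "y = (\<chi> i. if i \<in> J then 0 else x i)"
    have "peval f y = 0" by (rule vanish) (simp add: y_def)
    moreover have "peval f y =
        (\<Sum>m\<in>K. Poly_Mapping.lookup f m * (\<Prod>i\<in>UNIV. (y $ i) ^ Poly_Mapping.lookup m i))"
      unfolding peval_def
    proof (rule sum.mono_neutral_right)
      show "\<forall>m\<in>Poly_Mapping.keys f - K.
         Poly_Mapping.lookup f m * (\<Prod>i\<in>UNIV. (y $ i) ^ Poly_Mapping.lookup m i) = 0"
      proof
        fix m assume "m \<in> Poly_Mapping.keys f - K"
        then obtain i where "i \<in> J" "Poly_Mapping.lookup m i \<noteq> 0" by (auto simp: K_def)
        then have "(\<Prod>i\<in>UNIV. (y $ i) ^ Poly_Mapping.lookup m i) = 0"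
          by (intro prod_zero) (auto simp: y_def)
        then show "Poly_Mapping.lookup f m * (\<Prod>i\<in>UNIV. (y $ i) ^ Poly_Mapping.lookup m i) = 0"
          by simp
      qed
    qed (auto simp: K_def)
    moreover have "(\<Prod>i\<in>UNIV. (y $ i) ^ Poly_Mapping.lookup m i) =
        (\<Prod>i\<in>- J. x i ^ Poly_Mapping.lookup m i)" if "m \<in> K" for m
    proof -
      have "(\<Prod>i\<in>UNIV. (y $ i) ^ Poly_Mapping.lookup m i) =
          (\<Prod>i\<in>- J. (y $ i) ^ Poly_Mapping.lookup m i)"
        by (rule prod.mono_neutral_right) (use that in \<open>auto simp: K_def\<close>)
      also have "\<dots> = (\<Prod>i\<in>- J. x i ^ Poly_Mapping.lookup m i)"
        by (rule prod.cong) (auto simp: y_def)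
      finally show ?thesis .
    qed
    ultimately show "(\<Sum>m\<in>K. Poly_Mapping.lookup f m * (\<Prod>i\<in>- J. x i ^ Poly_Mapping.lookup m i)) = 0"
      by simp
  qed (auto simp: K_def)
  then show False using nz by simp
qed

section \<open>Squarefree monomials\<close>

definition sqfree_monomial :: "'n::finite set \<Rightarrow> 'n \<Rightarrow>\<^sub>0 nat" where
  "sqfree_monomial S = (\<Sum>i\<in>S. Poly_Mapping.single i 1)"

lemma lookup_sqfree_monomial:
  "Poly_Mapping.lookup (sqfree_monomial S) i = (if i \<in> S then 1 else 0)"
  by (simp add: sqfree_monomial_def lookup_sum lookup_single when_def)

lemma sqfree_monomial_inject: "sqfree_monomial S = sqfree_monomial T \<longleftrightarrow> S = T"
proof
  assume eq: "sqfree_monomial S = sqfree_monomial T"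
  have "i \<in> S \<longleftrightarrow> i \<in> T" for i
  proof -
    have "(if i \<in> S then 1 else 0 :: nat) = (if i \<in> T then 1 else 0)"
      by (simp only: lookup_sqfree_monomial[symmetric] eq)
    then show ?thesis by (auto split: if_splits)
  qed
  then show "S = T" by blast
qed simp

lemma prod_pvar: "(\<Prod>i\<in>S. pvar i) = Poly_Mapping.single (sqfree_monomial S) 1"
proof (induction S rule: infinite_finite_induct)
  case (insert i S)
  then show ?case by (simp add: pvar_def mult_single sqfree_monomial_def)
qed (auto simp: sqfree_monomial_def)

lemma pconst_times_single: "pconst c * Poly_Mapping.single m d = Poly_Mapping.single m (c * d)"
  by (simp add: pconst_def mult_single)

lemma prod_power_sqfree_monomial:
  fixes x :: "complex^'n::finite"
  shows "(\<Prod>i\<in>UNIV. (x $ i) ^ Poly_Mapping.lookup (sqfree_monomial S) i) = (\<Prod>i\<in>S. x $ i)"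
proof -
  have "(\<Prod>i\<in>UNIV. (x $ i) ^ Poly_Mapping.lookup (sqfree_monomial S) i) =
      (\<Prod>i\<in>S. (x $ i) ^ Poly_Mapping.lookup (sqfree_monomial S) i)"
    by (rule prod.mono_neutral_right) (auto simp: lookup_sqfree_monomial)
  then show ?thesis by (simp add: lookup_sqfree_monomial)
qed

text \<open>The exponents are at least 1 on \<open>S\<close> and at least 0 elsewhere. These lower
  bounds already add up to \<open>card S\<close>, so any strict excess would break the degree
  bound.\<close>

lemma eq_sqfree_monomial:
  assumes "(\<Sum>i\<in>UNIV. Poly_Mapping.lookup m i) \<le> card S"
    and "\<And>i. i \<in> S \<Longrightarrow> Poly_Mapping.lookup m i \<noteq> 0"
  shows "m = sqfree_monomial S"
proof (rule poly_mapping_eqI)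
  fix i
  let ?g = "\<lambda>i. if i \<in> S then 1 else 0 :: nat"
  have le: "?g j \<le> Poly_Mapping.lookup m j" for j using assms(2)[of j] by auto
  have "Poly_Mapping.lookup m i = ?g i"
  proof (rule ccontr)
    assume "Poly_Mapping.lookup m i \<noteq> ?g i"
    then have "?g i < Poly_Mapping.lookup m i" using le[of i] by linarith
    then have "sum ?g UNIV < (\<Sum>i\<in>UNIV. Poly_Mapping.lookup m i)"
      using le by (intro sum_strict_mono_ex1 bexI[of _ i]) auto
    moreover have "sum ?g UNIV = card S" by (simp add: sum.If_cases)
    ultimately show False using assms(1) by linarith
  qed
  then show "Poly_Mapping.lookup m i = Poly_Mapping.lookup (sqfree_monomial S) i"
    by (simp only: lookup_sqfree_monomial)
qed

section \<open>Projective planes and their linear subspaces\<close>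

lemma span_singleton_in_proj_space:
  fixes x :: "complex^'n"
  assumes "x \<noteq> 0"
  shows "vec.span {x} \<in> proj_space"
proof -
  have "vec.dim {x} = 1"
    using assms by (subst vec.dim_eq_card_independent) (auto simp: vec.dependent_single)
  then show ?thesis by (simp add: proj_space_def vec.subspace_span)
qed

text \<open>Passage from lines back to vectors: the line spanned by \<open>x\<close> is a point of
  the plane, and \<open>x\<close> lies on it.\<close>

lemma peval_eq_0_if_plane_subset:
  assumes "{L \<in> proj_space. L \<subseteq> W} \<subseteq> proj_zeros f" "vec.subspace W" "x \<in> W" "x \<noteq> 0"
  shows "peval f x = 0"
proof -
  have "vec.span {x} \<subseteq> W" using assms by (intro vec.span_minimal) auto
  then have "vec.span {x} \<in> proj_zeros f"
    using span_singleton_in_proj_space assms by blast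
  then show ?thesis by (auto simp: proj_zeros_def intro: vec.span_base)
qed

lemma coord_plane_eq: "coord_plane J = {L \<in> proj_space. L \<subseteq> {x. \<forall>i\<in>J. x $ i = 0}}"
  by (auto simp: coord_plane_def)

lemma subspace_coord: "vec.subspace {x :: complex^'n. \<forall>i\<in>J. x $ i = 0}"
  by (auto simp: vec.subspace_def)

lemma dim_coord: "vec.dim {x :: complex^'n. \<forall>i\<in>J. x $ i = 0} = CARD('n) - card J"
  using dim_substandard_cart[of "- J", where 'a = complex]
  by (simp add: Compl_eq_Diff_UNIV card_Diff_subset Ball_def)

lemma fanoI:
  assumes "\<Lambda> = {L \<in> proj_space. L \<subseteq> W}" "vec.subspace W" "int (vec.dim W) = k + 1"
    and "\<And>x. x \<in> W \<Longrightarrow> peval f x = 0"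
  shows "\<Lambda> \<in> fano k (proj_zeros f)"
  using assms by (auto simp: fano_def proj_planes_def proj_zeros_def)

text \<open>A shear in direction \<open>a\<close> maps the coordinate subspace \<open>insert a I\<close> onto the hyperplane section.\<close>

lemma dim_coord_hyperplane:
  fixes \<alpha> \<beta> :: complex and a b :: "'n::finite"
  assumes "\<beta> \<noteq> 0" "a \<notin> I" "b \<notin> I" "a \<noteq> b"
  shows "vec.dim {x :: complex^'n. (\<forall>i\<in>I. x $ i = 0) \<and> \<alpha> * x $ b + \<beta> * x $ a = 0} =
    CARD('n) - card (insert a I)"
proof -
  define S :: "complex^'n \<Rightarrow> complex^'n" where "S x = x + axis a (- (\<alpha> / \<beta>) * x $ b)" for x
  let ?V = "{x :: complex^'n. \<forall>i\<in>insert a I. x $ i = 0}"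
  have lin: "Vector_Spaces.linear (*s) (*s) S"
    by unfold_locales (auto simp: S_def vec_eq_iff axis_def algebra_simps)
  have inj: "inj_on S ?V"
  proof (rule inj_onI)
    fix x y assume xy: "x \<in> ?V" "y \<in> ?V" "S x = S y"
    have "x $ i = y $ i" for i
      using arg_cong[OF xy(3), of "\<lambda>z. z $ i"] xy(1,2) by (cases "i = a") (auto simp: S_def axis_def)
    then show "x = y" by (simp add: vec_eq_iff)
  qed
  have "S ` ?V = {x. (\<forall>i\<in>I. x $ i = 0) \<and> \<alpha> * x $ b + \<beta> * x $ a = 0}" (is "_ = ?W")
  proof
    show "S ` ?V \<subseteq> ?W" using assms by (auto simp: S_def axis_def)
    show "?W \<subseteq> S ` ?V"
    proof
      fix x assume x: "x \<in> ?W"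
      \<comment> \<open>The coordinate \<open>a\<close> may be forgotten, since the equation
        recovers it from \<open>x $ b\<close> by division by \<open>\<beta>\<close>.\<close>
      define y where "y = (\<chi> i. if i = a then 0 else x $ i)"
      have "\<beta> * x $ a = - \<alpha> * x $ b" using x by (simp add: eq_neg_iff_add_eq_0 add.commute)
      then have "x $ a = - (\<alpha> / \<beta>) * x $ b" using assms(1) by (simp add: field_simps)
      then have "x = S y" using assms(4) by (auto simp: S_def y_def vec_eq_iff axis_def)
      moreover have "y \<in> ?V" using x by (auto simp: y_def)
      ultimately show "x \<in> S ` ?V" by blast
    qed
  qed
  \<comment> \<open>Preservation of dimension is stated for maps injective on the span, which here
    is the subspace itself.\<close>
  moreover have "vec.span ?V = ?V"
    by (simp only: vec.span_eq_iff subspace_coord)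
  then have "vec.dim (S ` ?V) = vec.dim ?V"
    by (intro vec.dim_image_eq[OF lin]) (simp only: inj)
  ultimately show ?thesis by (simp only: dim_coord)
qed

lemma subspace_coord_hyperplane:
  "vec.subspace {x :: complex^'n. (\<forall>i\<in>I. x $ i = 0) \<and> \<alpha> * x $ b + \<beta> * x $ a = 0}"
proof -
  have "\<alpha> * (c * s) + \<beta> * (c * t) = c * (\<alpha> * s + \<beta> * t)" for c s t
    by (simp add: algebra_simps)
  moreover have "\<alpha> * (s + s') + \<beta> * (t + t') = (\<alpha> * s + \<beta> * t) + (\<alpha> * s' + \<beta> * t')" for s s' t t'
    by (simp add: algebra_simps)
  ultimately show ?thesis by (simp add: vec.subspace_def)
qed

subsection \<open>Facets and vertices\<close>

text \<open>\<open>x\<close> is the midpoint of the two perturbed points. If both lie in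
  \<open>P\<close>, then \<open>x\<close> is not extreme, and any face containing \<open>x\<close>
  contains both of them.\<close>

lemma mem_open_segment_perturb:
  fixes x z :: "real^'d"
  assumes "\<epsilon> > 0" "z \<noteq> 0"
  shows "x \<in> open_segment (x + \<epsilon> *\<^sub>R z) (x - \<epsilon> *\<^sub>R z)"
proof -
  have "(x + \<epsilon> *\<^sub>R z) + (x - \<epsilon> *\<^sub>R z) = 2 *\<^sub>R x"
    by (simp add: scaleR_2)
  then have "x = midpoint (x + \<epsilon> *\<^sub>R z) (x - \<epsilon> *\<^sub>R z)"
    by (simp add: midpoint_def)
  moreover have "x + \<epsilon> *\<^sub>R z \<noteq> x - \<epsilon> *\<^sub>R z"
  proof
    assume "x + \<epsilon> *\<^sub>R z = x - \<epsilon> *\<^sub>R z"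
    then have "\<epsilon> *\<^sub>R z + \<epsilon> *\<^sub>R z = 0" by (simp add: algebra_simps)
    then have "(\<epsilon> + \<epsilon>) *\<^sub>R z = 0" by (simp only: scaleR_add_left)
    then show False using assms by simp
  qed
  ultimately show ?thesis
    by (metis midpoint_in_open_segment)
qed

locale labelled_simple_polytope =
  fixes P :: "(real^'d) set"
    and Q :: "'n::finite \<Rightarrow> (real^'d) set"
    and U :: "real^'d^'n"
  assumes simple: "simple_polytope P"
    and labelling: "facet_labelling P Q"
    and rays: "ray_matrix P Q U"
begin

section \<open>Facet labels and the half-space description of \<open>P\<close>\<close>

lemma polytope: "polytope P"
  and full_dim: "aff_dim P = int CARD('d)"
  using simple by (auto simp: simple_polytope_def)

lemma convex: "convex P"
  using polytope by (rule polytope_imp_convex)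

lemma facet_Q: "Q i facet_of P"
  using labelling by (auto simp: facet_labelling_def bij_betw_def)

lemma facet_of_imp_Q: "F facet_of P \<Longrightarrow> \<exists>i. F = Q i"
  using labelling by (auto simp: facet_labelling_def bij_betw_def)

lemma inj_Q: "inj Q"
  using labelling by (auto simp: facet_labelling_def bij_betw_def)

lemma Q_nonempty: "Q i \<noteq> {}"
  and Q_face: "Q i face_of P"
  and Q_aff_dim: "aff_dim (Q i) = aff_dim P - 1"
  and Q_subset: "Q i \<subseteq> P"
  using facet_Q[of i] facet_of_imp_subset[OF facet_Q[of i]] by (auto simp: facet_of_def)

text \<open>The constant of the inequality that facet \<open>i\<close> contributes to
  \<open>P\<close>. The functional \<open>U $ i\<close> is constant on \<open>Q i\<close>, so the
  chosen point does not matter.\<close>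

definition height :: "'n \<Rightarrow> real" where
  "height i = U $ i \<bullet> (SOME x. x \<in> Q i)"

text \<open>At a vertex this is the set of rays of the corresponding maximal cone, by
  \<open>cone_rays_eq\<close>.\<close>

definition facets_at :: "real^'d \<Rightarrow> 'n set" where
  "facets_at x = {i. x \<in> Q i}"

lemma U_nonzero: "U $ i \<noteq> 0"
  using rays by (simp add: ray_matrix_def)

lemma U_minimal: "x \<in> Q i \<Longrightarrow> y \<in> P \<Longrightarrow> U $ i \<bullet> x \<le> U $ i \<bullet> y"
proof -
  have "U $ i = 1 *\<^sub>R U $ i" by simp
  then have "U $ i \<in> normal_cone P (Q i)"
    using rays unfolding ray_matrix_def by (metis (mono_tags, lifting) mem_Collect_eq zero_le_one)
  then show "x \<in> Q i \<Longrightarrow> y \<in> P \<Longrightarrow> U $ i \<bullet> x \<le> U $ i \<bullet> y"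
    by (simp add: normal_cone_def)
qed

lemma height_eq: "x \<in> Q i \<Longrightarrow> U $ i \<bullet> x = height i"
  unfolding height_def
  by (metis Q_subset U_minimal order_antisym someI subsetD)

lemma height_le: "x \<in> P \<Longrightarrow> height i \<le> U $ i \<bullet> x"
  using Q_nonempty[of i] U_minimal height_eq by fastforce

text \<open>The hyperplane section is a face of dimension at most \<open>aff_dim P - 1\<close>, and
  the facet is a face of it. A proper face would have smaller dimension than the section, but the
  facet already has \<open>aff_dim P - 1\<close>.\<close>

lemma Q_eq: "Q i = P \<inter> {x. U $ i \<bullet> x = height i}"
proof -
  let ?F = "P \<inter> {x. U $ i \<bullet> x = height i}"
  have face: "?F face_of P"
    by (rule face_of_Int_supporting_hyperplane_ge[OF convex height_le])
  have sub: "Q i \<subseteq> ?F"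
    using Q_subset height_eq by auto
  have "aff_dim ?F \<le> aff_dim {x. U $ i \<bullet> x = height i}"
    by (rule aff_dim_subset) auto
  then have F_dim: "aff_dim ?F \<le> aff_dim P - 1"
    using U_nonzero[of i] full_dim by simp
  show ?thesis
  proof (rule ccontr)
    assume "Q i \<noteq> ?F"
    moreover have "Q i face_of ?F"
      using face_of_subset[OF Q_face sub] by simp
    ultimately have "aff_dim (Q i) < aff_dim ?F"
      using face_of_aff_dim_lt face face_of_imp_convex by blast
    then show False using F_dim Q_aff_dim[of i] by simp
  qed
qed

lemma mem_Q_iff: "x \<in> Q i \<longleftrightarrow> x \<in> P \<and> U $ i \<bullet> x = height i"
  using Q_eq by auto

lemma mem_facets_at: "x \<in> P \<Longrightarrow> i \<in> facets_at x \<longleftrightarrow> U $ i \<bullet> x = height i"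
  by (simp add: facets_at_def mem_Q_iff)

text \<open>Suppose \<open>x\<close> satisfies all inequalities but lies outside. The segment from
  an interior point \<open>z\<close> to \<open>x\<close> meets the boundary, hence some facet
  \<open>i\<close>, at a point other than \<open>x\<close>. The inequality of \<open>i\<close> is
  strict at \<open>z\<close> and holds at \<open>x\<close>, so it is strict at that point too, a
  contradiction.\<close>

lemma mem_P_iff: "x \<in> P \<longleftrightarrow> (\<forall>i. height i \<le> U $ i \<bullet> x)"
proof
  assume x: "\<forall>i. height i \<le> U $ i \<bullet> x"
  have "interior P \<noteq> {}"
    using full_dim convex rel_interior_eq_empty[of P] rel_interior_interior[of P]
      aff_dim_eq_full[of P] by force
  then obtain z where z: "z \<in> interior P" by auto
  have zP: "z \<in> P" using z interior_subset by auto
  show "x \<in> P"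
  proof (rule ccontr)
    assume nx: "x \<notin> P"
    have "closed_segment z x \<inter> frontier P \<noteq> {}"
      by (rule connected_Int_frontier) (use zP nx in auto)
    then obtain y where y: "y \<in> closed_segment z x" "y \<in> frontier P" by auto
    have "rel_frontier P = frontier P"
      using rel_frontier_def frontier_def z rel_interior_nonempty_interior by (metis empty_iff)
    then obtain F where "F facet_of P" "y \<in> F"
      using y(2) rel_frontier_of_polyhedron[OF polytope_imp_polyhedron[OF polytope]] by auto
    then obtain i where i: "y \<in> Q i" using facet_of_imp_Q by auto
    have yP: "y \<in> P" using i Q_subset by auto
    have zi: "height i < U $ i \<bullet> z"
    proof (rule ccontr)
      assume "\<not> height i < U $ i \<bullet> z"
      then have "z \<in> Q i" using height_le[OF zP, of i] zP mem_Q_iff by force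
      moreover have "Q i \<inter> interior P = {}"
        using Q_aff_dim[of i] by (intro face_of_disjoint_interior Q_face) auto
      ultimately show False using z by auto
    qed
    obtain t where t: "y = (1 - t) *\<^sub>R z + t *\<^sub>R x" "0 \<le> t" "t \<le> 1"
      using y(1) by (auto simp: in_segment)
    have "t \<noteq> 1" using t yP nx by auto
    then have "(1 - t) * height i < (1 - t) * (U $ i \<bullet> z)" using zi t by simp
    moreover have "t * height i \<le> t * (U $ i \<bullet> x)" using x t by (simp add: mult_left_mono)
    moreover have "height i = (1 - t) * (U $ i \<bullet> z) + t * (U $ i \<bullet> x)"
      using height_eq[OF i] t by (simp add: inner_add_right)
    ultimately show False by (simp add: algebra_simps)
  qed
qed (use height_le in auto)

text \<open>The inequalities tight at \<open>x\<close> survive because \<open>z\<close> does not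
  decrease them; the finitely many others have slack and survive for small steps.\<close>

lemma move_inside:
  assumes "x \<in> P" "\<And>i. i \<in> facets_at x \<Longrightarrow> 0 \<le> U $ i \<bullet> z"
  shows "\<exists>\<epsilon>>0. \<forall>t. 0 \<le> t \<and> t \<le> \<epsilon> \<longrightarrow> x + t *\<^sub>R z \<in> P"
proof -
  have "\<exists>\<epsilon>>0. \<forall>t. 0 \<le> t \<and> t \<le> \<epsilon> \<longrightarrow> height i \<le> U $ i \<bullet> (x + t *\<^sub>R z)" for i
  proof (cases "i \<in> facets_at x")
    case True
    then show ?thesis
      using assms mem_facets_at by (intro exI[of _ 1]) (auto simp: inner_add_right)
  next
    case False
    then have gap: "0 < U $ i \<bullet> x - height i"
      using assms(1) mem_facets_at height_le[of x i] by force
    \<comment> \<open>Slack divided by a bound on the rate of change; the added 1 keeps the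
      denominator positive.\<close>
    let ?e = "(U $ i \<bullet> x - height i) / (\<bar>U $ i \<bullet> z\<bar> + 1)"
    have "height i \<le> U $ i \<bullet> (x + t *\<^sub>R z)" if "0 \<le> t" "t \<le> ?e" for t
    proof -
      have "t * \<bar>U $ i \<bullet> z\<bar> \<le> t * (\<bar>U $ i \<bullet> z\<bar> + 1)" using that by (intro mult_left_mono) auto
      also have "\<dots> \<le> U $ i \<bullet> x - height i" using that by (simp add: pos_le_divide_eq)
      finally have "t * \<bar>U $ i \<bullet> z\<bar> \<le> U $ i \<bullet> x - height i" .
      moreover have "- (t * \<bar>U $ i \<bullet> z\<bar>) \<le> t * (U $ i \<bullet> z)"
        using that by (metis abs_ge_minus_self abs_mult abs_of_nonneg minus_le_iff)
      ultimately show ?thesis by (simp add: inner_add_right)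
    qed
    then show ?thesis using gap by (intro exI[of _ ?e]) auto
  qed
  then obtain \<epsilon> where e: "\<And>i. \<epsilon> i > 0"
    "\<And>i t. 0 \<le> t \<Longrightarrow> t \<le> \<epsilon> i \<Longrightarrow> height i \<le> U $ i \<bullet> (x + t *\<^sub>R z)"
    by metis
  have "Min (range \<epsilon>) > 0" using e by simp
  moreover have "x + t *\<^sub>R z \<in> P" if "0 \<le> t" "t \<le> Min (range \<epsilon>)" for t
    using that e(2) by (auto simp: mem_P_iff)
  ultimately show ?thesis by blast
qed

lemma perturb:
  assumes "x \<in> P" "\<And>i. i \<in> facets_at x \<Longrightarrow> U $ i \<bullet> z = 0"
  obtains \<epsilon> where "\<epsilon> > 0" "x + \<epsilon> *\<^sub>R z \<in> P" "x - \<epsilon> *\<^sub>R z \<in> P"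
proof -
  obtain a where a: "a > 0" "\<And>t. 0 \<le> t \<Longrightarrow> t \<le> a \<Longrightarrow> x + t *\<^sub>R z \<in> P"
    using move_inside[OF assms(1), of z] assms(2) by auto
  obtain b where b: "b > 0" "\<And>t. 0 \<le> t \<Longrightarrow> t \<le> b \<Longrightarrow> x + t *\<^sub>R (- z) \<in> P"
    using move_inside[OF assms(1), of "- z"] assms(2) by auto
  show thesis
    by (rule that[of "min a b"]) (use a b(1) b(2)[of "min a b"] in auto)
qed

text \<open>The slack at an interior point of the segment is a positive combination of the
  nonnegative slacks at the ends, so it vanishes only if both do.\<close>

lemma facets_at_segment:
  assumes "a \<in> P" "b \<in> P" "x \<in> open_segment a b"
  shows "facets_at x = facets_at a \<inter> facets_at b"
proof -
  have xP: "x \<in> P"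
    using assms convex convex_contains_open_segment by blast
  obtain t where t: "0 < t" "t < 1" "x = (1 - t) *\<^sub>R a + t *\<^sub>R b"
    using assms(3) by (auto simp: in_segment)
  have "U $ i \<bullet> x = height i \<longleftrightarrow> U $ i \<bullet> a = height i \<and> U $ i \<bullet> b = height i" for i
  proof -
    have "U $ i \<bullet> x - height i = (1 - t) * (U $ i \<bullet> a - height i) + t * (U $ i \<bullet> b - height i)"
      unfolding t(3) by (simp add: inner_add_right algebra_simps)
    moreover have "0 \<le> U $ i \<bullet> a - height i" "0 \<le> U $ i \<bullet> b - height i"
      using height_le assms by auto
    ultimately have "U $ i \<bullet> x - height i = 0 \<longleftrightarrow>
       (1 - t) * (U $ i \<bullet> a - height i) = 0 \<and> t * (U $ i \<bullet> b - height i) = 0"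
      using t(1,2) by (simp add: add_nonneg_eq_0_iff)
    then show ?thesis using t by simp
  qed
  then show ?thesis
    using mem_facets_at assms xP by auto
qed

text \<open>A vector annihilated by all facets at \<open>v\<close> can be added to and subtracted
  from \<open>v\<close> inside \<open>P\<close> after scaling, which extremality forbids unless it
  is zero. Conversely, if \<open>v\<close> lies inside a segment of \<open>P\<close>, the facets at
  \<open>v\<close> annihilate the direction of the segment.\<close>

lemma extreme_point_iff:
  "v extreme_point_of P \<longleftrightarrow>
     v \<in> P \<and> (\<forall>z. (\<forall>i\<in>facets_at v. U $ i \<bullet> z = 0) \<longrightarrow> z = 0)"
proof (intro iffI conjI allI impI)
  fix z
  assume v: "v extreme_point_of P" and z: "\<forall>i\<in>facets_at v. U $ i \<bullet> z = 0"
  have vP: "v \<in> P" using v by (simp add: extreme_point_of_def)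
  obtain \<epsilon> where e: "\<epsilon> > 0" "v + \<epsilon> *\<^sub>R z \<in> P" "v - \<epsilon> *\<^sub>R z \<in> P"
    using perturb[OF vP, of z] z by auto
  then show "z = 0"
    using v mem_open_segment_perturb[OF e(1), of z v] by (auto simp: extreme_point_of_def)
next
  assume v: "v \<in> P \<and> (\<forall>z. (\<forall>i\<in>facets_at v. U $ i \<bullet> z = 0) \<longrightarrow> z = 0)"
  show "v extreme_point_of P"
    unfolding extreme_point_of_def
  proof (intro conjI ballI notI)
    fix a b assume ab: "a \<in> P" "b \<in> P" "v \<in> open_segment a b"
    have "U $ i \<bullet> (a - b) = 0" if "i \<in> facets_at v" for i
      using that facets_at_segment[OF ab] ab mem_facets_at by (simp add: inner_diff_right)
    then have "a - b = 0" using v by blast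
    then show False using ab(3) by simp
  qed (use v in auto)
qed (simp add: extreme_point_of_def)

lemma vertex_in_P: "v extreme_point_of P \<Longrightarrow> v \<in> P"
  by (simp add: extreme_point_of_def)

lemma vertex_orthogonal:
  "v extreme_point_of P \<Longrightarrow> (\<And>i. i \<in> facets_at v \<Longrightarrow> U $ i \<bullet> z = 0) \<Longrightarrow> z = 0"
  using extreme_point_iff by blast

lemma card_facets_at: "v extreme_point_of P \<Longrightarrow> card (facets_at v) = CARD('d)"
proof -
  assume v: "v extreme_point_of P"
  have "Q ` facets_at v = {F. F facet_of P \<and> v \<in> F}"
  proof (intro subset_antisym subsetI)
    fix F assume F: "F \<in> {F. F facet_of P \<and> v \<in> F}"
    then obtain i where "F = Q i" using facet_of_imp_Q by blast
    then show "F \<in> Q ` facets_at v" using F by (simp add: facets_at_def)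
  qed (auto simp: facets_at_def facet_Q)
  then show ?thesis
    using simple v card_image[OF inj_on_subset[OF inj_Q subset_UNIV], of "facets_at v"]
    by (simp add: simple_polytope_def)
qed

text \<open>The other rows at \<open>v\<close> are fewer than the dimension, so some nonzero vector
  is orthogonal to all of them. As \<open>v\<close> is a vertex, it is not orthogonal to row
  \<open>j\<close> as well and can be scaled.\<close>

lemma ex_dual_vector:
  assumes v: "v extreme_point_of P" and j: "j \<in> facets_at v"
  shows "\<exists>w. U $ j \<bullet> w = 1 \<and> (\<forall>i\<in>facets_at v - {j}. U $ i \<bullet> w = 0)"
proof -
  let ?S = "($) U ` (facets_at v - {j})"
  have "dim ?S \<le> card ?S" by (rule dim_le_card') simp
  also have "\<dots> \<le> card (facets_at v - {j})" by (rule card_image_le) simp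
  also have "\<dots> < CARD('d)" using card_facets_at[OF v] j by simp
  finally have "dim ?S < DIM(real^'d)" by simp
  then obtain z where z: "z \<noteq> 0" "span ?S \<subseteq> {x. z \<bullet> x = 0}"
    using lowdim_subset_hyperplane by blast
  have zi: "U $ i \<bullet> z = 0" if "i \<in> facets_at v - {j}" for i
    using z(2) that span_base[of "U $ i" ?S] by (auto simp: inner_commute)
  have "U $ j \<bullet> z \<noteq> 0"
    using vertex_orthogonal[OF v, of z] zi z(1) by blast
  then show ?thesis
    using zi by (intro exI[of _ "(1 / (U $ j \<bullet> z)) *\<^sub>R z"]) auto
qed

subsection \<open>Edges\<close>

text \<open>The ray from \<open>v\<close> along \<open>z\<close> leaves facet \<open>j\<close> and
  stays on the other facets at \<open>v\<close>. It starts inside \<open>P\<close> by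
  \<open>move_inside\<close> and must leave by boundedness; its last point in \<open>P\<close> is
  the other end of the edge.\<close>

lemma edge_from_vertex:
  assumes v: "v extreme_point_of P" and j: "j \<in> facets_at v"
    and z: "U $ j \<bullet> z = 1" "\<And>i. i \<in> facets_at v - {j} \<Longrightarrow> U $ i \<bullet> z = 0"
  obtains s where "s > 0" "(v + s *\<^sub>R z) extreme_point_of P"
    "closed_segment v (v + s *\<^sub>R z) edge_of P"
proof -
  have vP: "v \<in> P" using v by (rule vertex_in_P)
  have z0: "z \<noteq> 0" using z by auto
  let ?T = "{0..} \<inter> (\<lambda>t. v + t *\<^sub>R z) -` P"
  have "closed ?T"
    by (intro closed_Int closed_atLeast closed_vimage polytope_imp_closed[OF polytope] continuous_intros)
  moreover have "bounded ?T"
  proof -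
    obtain B where B: "\<And>x. x \<in> P \<Longrightarrow> norm x \<le> B"
      using polytope_imp_bounded[OF polytope] by (auto simp: bounded_iff)
    have "norm t \<le> (B + norm v) / norm z" if "t \<in> ?T" for t
    proof -
      have "norm (t *\<^sub>R z) \<le> norm (v + t *\<^sub>R z) + norm v"
        using norm_triangle_ineq4[of "v + t *\<^sub>R z" v] by simp
      also have "\<dots> \<le> B + norm v" using that B by simp
      finally show ?thesis using z0 by (simp add: pos_le_divide_eq)
    qed
    then show ?thesis by (auto simp: bounded_iff)
  qed
  ultimately have compact: "compact ?T" by (simp add: compact_eq_bounded_closed)
  have "?T \<noteq> {}" using vP by (auto intro!: exI[of _ 0])
  then obtain s where s: "s \<in> ?T" "\<And>t. t \<in> ?T \<Longrightarrow> t \<le> s"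
    using compact_attains_sup[OF compact] by blast
  obtain \<epsilon> where e: "\<epsilon> > 0" "\<And>t. 0 \<le> t \<Longrightarrow> t \<le> \<epsilon> \<Longrightarrow> v + t *\<^sub>R z \<in> P"
  proof -
    have "0 \<le> U $ i \<bullet> z" if "i \<in> facets_at v" for i
      using z that by (cases "i = j") auto
    then show ?thesis using move_inside[OF vP] that by blast
  qed
  have "\<epsilon> \<le> s" using s(2)[of \<epsilon>] e by simp
  then have s0: "s > 0" using e by simp
  let ?w = "v + s *\<^sub>R z"
  have wP: "?w \<in> P" using s by simp
  \<comment> \<open>The face cut out by the other facets at \<open>v\<close>. Inserting
    \<open>P\<close> covers dimension one, where there are none.\<close>
  define E where "E = \<Inter> (insert P (Q ` (facets_at v - {j})))"
  have E_face: "E face_of P"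
    unfolding E_def by (rule face_of_Inter) (auto simp: Q_face face_of_refl convex)
  have "E = closed_segment v ?w"
  proof
    have "v \<in> E" using vP by (auto simp: E_def facets_at_def)
    moreover have "?w \<in> E"
      using wP z vP by (auto simp: E_def mem_Q_iff mem_facets_at inner_add_right)
    ultimately show "closed_segment v ?w \<subseteq> E"
      using E_face face_of_imp_convex closed_segment_subset by blast
    show "E \<subseteq> closed_segment v ?w"
    proof
      fix x assume x: "x \<in> E"
      have xP: "x \<in> P" using x by (simp add: E_def)
      \<comment> \<open>The slack of facet \<open>j\<close> at \<open>x\<close>. Since
        \<open>U $ j\<close> takes the value 1 on \<open>z\<close>, this is the only possible
        parameter of \<open>x\<close> on the ray.\<close>
      define r where "r = U $ j \<bullet> x - height j"
      have "U $ i \<bullet> (x - v - r *\<^sub>R z) = 0" if "i \<in> facets_at v" for i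
      proof (cases "i = j")
        case True
        then show ?thesis using z j vP
          by (simp add: r_def inner_diff_right mem_facets_at)
      next
        case False
        then have "x \<in> Q i" using x that by (simp add: E_def)
        then show ?thesis using z(2)[of i] False that vP
          by (simp add: inner_diff_right mem_facets_at mem_Q_iff)
      qed
      then have "x - v - r *\<^sub>R z = 0" by (rule vertex_orthogonal[OF v])
      then have xr: "x = v + r *\<^sub>R z" by (simp add: algebra_simps)
      have "0 \<le> r" using height_le[OF xP] by (simp add: r_def)
      then have "r \<le> s" using s(2)[of r] xr xP by simp
      have "x = (1 - r / s) *\<^sub>R v + (r / s) *\<^sub>R ?w"
        using xr s0 by (simp add: algebra_simps)
      then show "x \<in> closed_segment v ?w"
        using \<open>0 \<le> r\<close> \<open>r \<le> s\<close> s0 by (auto simp: in_segment intro!: exI[of _ "r / s"])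
    qed
  qed
  then have face: "closed_segment v ?w face_of P" using E_face by simp
  have "aff_dim (closed_segment v ?w) = 1"
    using s0 z0 by (simp add: segment_convex_hull aff_dim_convex_hull)
  then have "closed_segment v ?w edge_of P" using face by (simp add: edge_of_def)
  moreover have "?w extreme_point_of P"
    using extreme_point_of_face[OF face] extreme_point_of_segment by blast
  ultimately show thesis using that s0 by blast
qed

section \<open>Ends, facets and direction of a given edge\<close>

lemma edge_segment:
  assumes e: "e edge_of P" and ends: "{z. z extreme_point_of e} = {v, w}"
  shows "e = closed_segment v w" "v extreme_point_of P" "w extreme_point_of P"
proof -
  have face: "e face_of P" using e by (simp add: edge_of_def)
  then have "polytope e" using face_of_polytope_polytope polytope by blast
  then have "e = convex hull {z. z extreme_point_of e}"
    by (intro Krein_Milman_Minkowski polytope_imp_compact polytope_imp_convex)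
  then show "e = closed_segment v w" by (simp add: ends segment_convex_hull)
  show "v extreme_point_of P" "w extreme_point_of P"
    using ends extreme_point_of_face[OF face] by auto
qed

lemma facets_containing_segment:
  assumes "v \<in> P" "w \<in> P"
  shows "{i. closed_segment v w \<subseteq> Q i} = facets_at v \<inter> facets_at w"
proof -
  have "closed_segment v w \<subseteq> Q i \<longleftrightarrow> v \<in> Q i \<and> w \<in> Q i" for i
    using face_of_imp_convex[OF Q_face[of i]] closed_segment_subset by blast
  then show ?thesis by (auto simp: facets_at_def)
qed

text \<open>At the midpoint only the facets common to both ends are tight, so it can be moved by a
  multiple of \<open>z\<close> both ways within \<open>P\<close>. The edge is a face and therefore
  contains the moved points, which makes \<open>z\<close> parallel to it.\<close>

lemma edge_direction:
  assumes e: "closed_segment v w edge_of P" and vw: "v \<noteq> w"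
    and z: "\<And>i. i \<in> facets_at v \<inter> facets_at w \<Longrightarrow> U $ i \<bullet> z = 0"
  shows "\<exists>r. z = r *\<^sub>R (w - v)"
proof (cases "z = 0")
  case False
  have face: "closed_segment v w face_of P" using e by (simp add: edge_of_def)
  then have sub: "closed_segment v w \<subseteq> P" by (rule face_of_imp_subset)
  have vP: "v \<in> P" and wP: "w \<in> P" using sub by auto
  let ?m = "midpoint v w"
  have mid: "?m \<in> open_segment v w" using vw by simp
  have mP: "?m \<in> P" using sub by auto
  obtain \<epsilon> where eps: "\<epsilon> > 0" "?m + \<epsilon> *\<^sub>R z \<in> P" "?m - \<epsilon> *\<^sub>R z \<in> P"
    using perturb[OF mP, of z] z facets_at_segment[OF vP wP mid] by auto
  have "?m + \<epsilon> *\<^sub>R z \<in> closed_segment v w"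
    using face_ofD[OF face mem_open_segment_perturb[OF eps(1) False] eps(2,3)]
    by (simp add: midpoint_in_closed_segment)
  then obtain t where t: "?m + \<epsilon> *\<^sub>R z = (1 - t) *\<^sub>R v + t *\<^sub>R w" by (auto simp: in_segment)
  have "\<epsilon> *\<^sub>R z = ((1 - t) *\<^sub>R v + t *\<^sub>R w) - ?m" using t by (simp add: algebra_simps)
  also have "\<dots> = (t - 1/2) *\<^sub>R (w - v)"
    by (vector midpoint_def) (simp add: field_simps)
  finally have "(1 / \<epsilon>) *\<^sub>R \<epsilon> *\<^sub>R z = (1 / \<epsilon>) *\<^sub>R (t - 1/2) *\<^sub>R (w - v)" by simp
  then show ?thesis using eps(1) by auto
qed auto

text \<open>Suppose the edge left two facets \<open>j\<close> and \<open>k\<close> at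
  \<open>v\<close>. The dual vector of \<open>k\<close> vanishes on the common facets, hence is
  parallel to the edge. It also vanishes on \<open>j\<close>, where the edge direction does not, so
  it would be zero.\<close>

lemma facets_at_diff_singleton:
  assumes e: "closed_segment v w edge_of P" and vw: "v \<noteq> w" and v: "v extreme_point_of P"
  shows "\<exists>a. facets_at v - facets_at w = {a}"
proof -
  have wP: "w \<in> P"
    using e by (meson edge_of_imp_subset ends_in_segment(2) subsetD)
  have vP: "v \<in> P" using v by (rule vertex_in_P)
  obtain j where j: "j \<in> facets_at v" "U $ j \<bullet> (w - v) \<noteq> 0"
    using vertex_orthogonal[OF v, of "w - v"] vw by auto
  then have jw: "j \<notin> facets_at w"
    using vP wP by (auto simp: mem_facets_at inner_diff_right)
  have "k = j" if k: "k \<in> facets_at v - facets_at w" for k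
  proof (rule ccontr)
    assume "k \<noteq> j"
    obtain z where z: "U $ k \<bullet> z = 1" "\<And>i. i \<in> facets_at v - {k} \<Longrightarrow> U $ i \<bullet> z = 0"
      using ex_dual_vector[OF v, of k] k by blast
    have "\<exists>r. z = r *\<^sub>R (w - v)"
      by (rule edge_direction[OF e vw]) (use z(2) k in auto)
    then obtain r where r: "z = r *\<^sub>R (w - v)" ..
    have "U $ j \<bullet> z = 0" using z(2) j \<open>k \<noteq> j\<close> by auto
    then have "r = 0" using r j by simp
    then show False using z(1) r by simp
  qed
  then show ?thesis using j jw by blast
qed

text \<open>Interior points of the segment lie only on facets common to both ends, so facet
  \<open>a\<close> meets the segment in \<open>v\<close> alone. Conversely, a facet with that
  property contains \<open>v\<close> and not \<open>w\<close>.\<close>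

lemma end_facet_eq:
  assumes P: "v \<in> P" "w \<in> P" and a: "facets_at v - facets_at w = {a}"
  shows "end_facet Q (closed_segment v w) v = a"
  unfolding end_facet_def
proof (rule the_equality)
  have av: "v \<in> Q a" and aw: "w \<notin> Q a" using a by (auto simp: facets_at_def)
  have "closed_segment v w \<inter> Q a \<subseteq> {v}"
  proof
    fix x assume x: "x \<in> closed_segment v w \<inter> Q a"
    then consider "x = v" | "x = w" | "x \<in> open_segment v w"
      by (auto simp: open_segment_def)
    then show "x \<in> {v}"
    proof cases
      case 3
      then have "a \<in> facets_at w"
        using facets_at_segment[OF P, of x] x by (auto simp: facets_at_def)
      then show ?thesis using a by auto
    qed (use x aw in auto)
  qed
  then show "\<not> closed_segment v w \<subseteq> Q a \<and> closed_segment v w \<inter> Q a = {v}"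
    using av aw by auto
next
  fix i assume i: "\<not> closed_segment v w \<subseteq> Q i \<and> closed_segment v w \<inter> Q i = {v}"
  then have "i \<in> facets_at v" by (auto simp: facets_at_def)
  moreover have "i \<notin> facets_at w"
    using i facets_containing_segment[OF P] \<open>i \<in> facets_at v\<close> by blast
  ultimately show "i = a" using a by blast
qed

text \<open>The common facets force \<open>u\<close> onto the line through \<open>v\<close> and
  \<open>w\<close>. Of three distinct points on a line one lies strictly between the others, which
  no vertex does.\<close>

lemma edge_vertices:
  assumes e: "closed_segment v w edge_of P" and vw: "v \<noteq> w"
    and v: "v extreme_point_of P" and w: "w extreme_point_of P" and u: "u extreme_point_of P"
    and sub: "facets_at v \<inter> facets_at w \<subseteq> facets_at u"
  shows "u = v \<or> u = w"
proof -
  have P: "u \<in> P" "v \<in> P" "w \<in> P" using u v w by (auto dest: vertex_in_P)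
  have "\<exists>r. u - v = r *\<^sub>R (w - v)"
    by (rule edge_direction[OF e vw])
      (use sub P in \<open>auto simp: mem_facets_at inner_diff_right subset_iff\<close>)
  then obtain r where r: "u - v = r *\<^sub>R (w - v)" ..
  have sum_u: "u = (1 - r) *\<^sub>R v + r *\<^sub>R w" using r by (simp add: algebra_simps)
  have extreme: "x \<notin> open_segment a b" if "x extreme_point_of P" "a \<in> P" "b \<in> P" for x a b
    using that by (auto simp: extreme_point_of_def)
  consider "r < 0" | "r = 0" | "0 < r" "r < 1" | "r = 1" | "r > 1" by linarith
  then show ?thesis
  proof cases
    case 1
    \<comment> \<open>Solving \<open>sum_u\<close> for \<open>v\<close> gives this coefficient of
      \<open>w\<close>.\<close>
    let ?t = "- r / (1 - r)"
    have "v = (1 - ?t) *\<^sub>R u + ?t *\<^sub>R w"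
    proof -
      have t: "(1 - r) * ?t = - r" "(1 - r) * (1 - ?t) = 1" using 1 by (auto simp: field_simps)
      have "(1 - r) *\<^sub>R v = (1 - r) *\<^sub>R ((1 - ?t) *\<^sub>R u + ?t *\<^sub>R w)"
        unfolding scaleR_right_distrib scaleR_scaleR t using sum_u by (simp add: algebra_simps)
      then show ?thesis using 1 by simp
    qed
    moreover have "u \<noteq> w" using sum_u 1 vw r by (auto simp: algebra_simps)
    moreover have "0 < ?t" "?t < 1" using 1 by (auto simp: field_simps)
    ultimately have "v \<in> open_segment u w" by (auto simp only: in_segment)
    then show ?thesis using extreme[OF v] P by blast
  next
    case 3
    then have "u \<in> open_segment v w" using sum_u vw by (auto simp: in_segment)
    then show ?thesis using extreme[OF u] P by blast
  next
    case 5
    \<comment> \<open>Solving \<open>sum_u\<close> for \<open>w\<close> gives this coefficient of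
      \<open>u\<close>.\<close>
    let ?t = "1 / r"
    have "w = (1 - ?t) *\<^sub>R v + ?t *\<^sub>R u"
    proof -
      have t: "r * ?t = 1" "r * (1 - ?t) = r - 1" using 5 by (auto simp: field_simps)
      have "r *\<^sub>R w = r *\<^sub>R ((1 - ?t) *\<^sub>R v + ?t *\<^sub>R u)"
        unfolding scaleR_right_distrib scaleR_scaleR t using sum_u by (simp add: algebra_simps)
      then show ?thesis using 5 by simp
    qed
    moreover have "u \<noteq> v" using r 5 vw by auto
    ultimately have "w \<in> open_segment v u" using 5 by (auto simp: in_segment intro!: exI[of _ ?t])
    then show ?thesis using extreme[OF w] P by blast
  qed (use sum_u in auto)
qed

section \<open>Existence of vertices and connectedness of the graph\<close>

lemma facets_at_inj:
  assumes v: "v extreme_point_of P" and w: "w extreme_point_of P"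
    and "facets_at v \<subseteq> facets_at w"
  shows "v = w"
  using vertex_orthogonal[OF v, of "v - w"] assms vertex_in_P
  by (auto simp: mem_facets_at inner_diff_right subset_iff)

text \<open>The facets in \<open>S\<close> cut out a face, nonempty because of \<open>x\<close>, and
  every extreme point of that face is a vertex of \<open>P\<close>.\<close>

lemma ex_vertex:
  assumes "S \<subseteq> facets_at x" "x \<in> P"
  shows "\<exists>v. v extreme_point_of P \<and> S \<subseteq> facets_at v"
proof -
  define G where "G = \<Inter> (insert P (Q ` S))"
  have G: "G face_of P"
    unfolding G_def by (rule face_of_Inter) (auto simp: Q_face face_of_refl convex)
  then have "polytope G" using face_of_polytope_polytope polytope by blast
  moreover have "x \<in> G" using assms by (auto simp: G_def facets_at_def)
  ultimately obtain v where "v extreme_point_of G"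
    using extreme_point_exists_convex[of G] polytope_imp_compact polytope_imp_convex by blast
  then have "v extreme_point_of P" "v \<in> G" using extreme_point_of_face[OF G] by auto
  then show ?thesis by (auto simp: G_def facets_at_def)
qed

lemma vertex_exists: "\<exists>v. v extreme_point_of P"
proof -
  obtain i :: 'n where True by blast
  obtain x where "x \<in> Q i" using Q_nonempty by auto
  then show ?thesis using ex_vertex[of "{}" x] Q_subset by blast
qed

text \<open>
  The simplex method: a vertex \<open>v\<close> that does not minimize a linear functional \<open>G\<close> has an edge
  along which \<open>G\<close> decreases, as the dual vectors of the facets at \<open>v\<close> generate the cone of \<open>P\<close> at \<open>v\<close>.
\<close>

lemma improving_edge:
  assumes v: "v extreme_point_of P" and x: "x \<in> P" and less: "G \<bullet> x < G \<bullet> v"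
  shows "\<exists>w. w extreme_point_of P \<and> w \<noteq> v \<and> closed_segment v w edge_of P \<and> G \<bullet> w < G \<bullet> v"
proof -
  let ?I = "facets_at v"
  have vP: "v \<in> P" using v by (rule vertex_in_P)
  have "\<forall>j\<in>?I. \<exists>z. U $ j \<bullet> z = 1 \<and> (\<forall>i\<in>?I - {j}. U $ i \<bullet> z = 0)"
    using ex_dual_vector[OF v] by blast
  then obtain z where z: "\<And>j. j \<in> ?I \<Longrightarrow> U $ j \<bullet> z j = 1"
      "\<And>i j. j \<in> ?I \<Longrightarrow> i \<in> ?I - {j} \<Longrightarrow> U $ i \<bullet> z j = 0"
    by metis
  have "\<exists>j\<in>?I. G \<bullet> z j < 0"
  proof (rule ccontr)
    assume "\<not> (\<exists>j\<in>?I. G \<bullet> z j < 0)"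
    then have nonneg: "0 \<le> G \<bullet> z j" if "j \<in> ?I" for j using that by force
    \<comment> \<open>The expansion of \<open>x - v\<close> in the dual vectors. Its coefficients
      are the slacks of \<open>x\<close> at the facets through \<open>v\<close>, hence
      nonnegative.\<close>
    let ?s = "\<Sum>j\<in>?I. (U $ j \<bullet> (x - v)) *\<^sub>R z j"
    have "x - v - ?s = 0"
    proof (rule vertex_orthogonal[OF v])
      fix i assume i: "i \<in> ?I"
      have "U $ i \<bullet> ?s = (\<Sum>j\<in>?I. if j = i then U $ i \<bullet> (x - v) else 0)"
        unfolding inner_sum_right by (rule sum.cong) (use z i in auto)
      also have "\<dots> = U $ i \<bullet> (x - v)" using i by simp
      finally show "U $ i \<bullet> (x - v - ?s) = 0" by (simp add: inner_diff_right)
    qed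
    then have "G \<bullet> (x - v) = G \<bullet> ?s" by simp
    also have "\<dots> = (\<Sum>j\<in>?I. (U $ j \<bullet> (x - v)) * (G \<bullet> z j))" by (simp add: inner_sum_right)
    also have "\<dots> \<ge> 0"
      using height_le[OF x] vP nonneg
      by (intro sum_nonneg mult_nonneg_nonneg) (auto simp: inner_diff_right mem_facets_at)
    finally show False using less by (simp add: inner_diff_right)
  qed
  then obtain j where j: "j \<in> ?I" "G \<bullet> z j < 0" by blast
  obtain s where s: "s > 0" "(v + s *\<^sub>R z j) extreme_point_of P"
      "closed_segment v (v + s *\<^sub>R z j) edge_of P"
    using edge_from_vertex[OF v j(1), of "z j"] z j(1) by blast
  have "G \<bullet> (v + s *\<^sub>R z j) < G \<bullet> v"
    using s(1) j(2) by (simp add: inner_add_right mult_pos_neg)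
  then show ?thesis using s by (intro exI[of _ "v + s *\<^sub>R z j"]) auto
qed

lemma finite_vertices: "finite {v. v extreme_point_of P}"
  using finite_polyhedron_extreme_points polytope_imp_polyhedron polytope by blast

text \<open>Connectedness as a propagation rule: improving edges lead from any vertex to
  \<open>v0\<close>, because each of them strictly reduces the number of vertices with smaller value
  of \<open>G\<close>.\<close>

lemma vertex_connected:
  assumes v: "v extreme_point_of P" and v0: "v0 extreme_point_of P" and base: "R v0"
    and step: "\<And>v w. v extreme_point_of P \<Longrightarrow> w extreme_point_of P \<Longrightarrow> v \<noteq> w \<Longrightarrow>
      closed_segment v w edge_of P \<Longrightarrow> R w \<Longrightarrow> R v"
  shows "R v"
proof -
  \<comment> \<open>\<open>G\<close> is minimized exactly at \<open>v0\<close>.\<close>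
  define G where "G = (\<Sum>i\<in>facets_at v0. U $ i)"
  have G_less: "G \<bullet> v0 < G \<bullet> v" if v: "v extreme_point_of P" "v \<noteq> v0" for v
  proof -
    have P: "v \<in> P" "v0 \<in> P" using v v0 by (auto dest: vertex_in_P)
    obtain i where i: "i \<in> facets_at v0" "i \<notin> facets_at v"
      using facets_at_inj[OF v0 v(1)] v(2) by auto
    have "(\<Sum>i\<in>facets_at v0. U $ i \<bullet> v0) < (\<Sum>i\<in>facets_at v0. U $ i \<bullet> v)"
    proof (rule sum_strict_mono_ex1)
      show "\<forall>i\<in>facets_at v0. U $ i \<bullet> v0 \<le> U $ i \<bullet> v"
        using P height_le by (auto simp: mem_facets_at)
      have "U $ i \<bullet> v0 < U $ i \<bullet> v"
        using i P height_le[OF P(1), of i] by (auto simp: mem_facets_at)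
      then show "\<exists>i\<in>facets_at v0. U $ i \<bullet> v0 < U $ i \<bullet> v" using i by blast
    qed simp
    then show ?thesis by (simp add: G_def inner_sum_left)
  qed
  let ?below = "\<lambda>v. {u. u extreme_point_of P \<and> G \<bullet> u < G \<bullet> v}"
  show ?thesis
    using v
  proof (induction "card (?below v)" arbitrary: v rule: less_induct)
    case (less v)
    show ?case
    proof (cases "v = v0")
      case False
      have "v0 \<in> P" using v0 by (rule vertex_in_P)
      then obtain w where w: "w extreme_point_of P" "w \<noteq> v" "closed_segment v w edge_of P"
          "G \<bullet> w < G \<bullet> v"
        using improving_edge[OF less.prems _ G_less[OF less.prems False]]
        by blast
      have "?below w \<subset> ?below v" using w by force
      then have "card (?below w) < card (?below v)"
        by (rule psubset_card_mono[rotated]) (use finite_vertices in simp)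
      then have "R w" using less.hyps w(1) by blast
      then show ?thesis using step[of v w] less.prems w by blast
    qed (use base in simp)
  qed
qed

subsection \<open>The normal fan\<close>

lemma normal_cone_Q: "normal_cone P (Q i) = {t *\<^sub>R U $ i | t. t \<ge> 0}"
  using rays by (simp add: ray_matrix_def)

text \<open>The ray contains the origin, so its affine dimension is the linear dimension of its
  span, the line through \<open>U $ i\<close>.\<close>

lemma normal_cone_Q_ray: "normal_cone P (Q i) \<in> fan_cones (normal_fan P) 1"
proof -
  let ?R = "{t *\<^sub>R U $ i | t. t \<ge> 0}"
  have 0: "0 \<in> ?R" by (auto intro!: exI[of _ 0])
  have "U $ i \<in> ?R" by (auto intro!: exI[of _ 1])
  then have "span {U $ i} \<subseteq> span ?R" by (intro span_mono) auto
  moreover have "span ?R \<subseteq> span {U $ i}"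
    by (intro span_minimal subspace_span) (auto intro: span_base span_scale)
  ultimately have "span ?R = span {U $ i}" by blast
  then have "dim ?R = dim {U $ i}" using dim_span[of ?R] dim_span[of "{U $ i}"] by argo
  moreover have "dim {U $ i} = 1"
    using U_nonzero[of i] by (subst dim_eq_card_independent) (auto simp: dependent_single)
  ultimately have "aff_dim ?R = 1"
    using aff_dim_zero[OF hull_inc[OF 0]] by linarith
  then have "aff_dim (normal_cone P (Q i)) = int 1" by (simp only: normal_cone_Q)
  moreover have "normal_cone P (Q i) \<in> normal_fan P"
    using Q_face[of i] Q_nonempty[of i] unfolding normal_fan_def by blast
  ultimately show ?thesis unfolding fan_cones_def by blast
qed

text \<open>Forwards, \<open>U $ i\<close> lies in the cone of \<open>v\<close>, so \<open>v\<close>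
  minimizes it. Backwards, let a proper convex combination of two functionals minimal at
  \<open>v\<close> be minimal on the facet. Neither can grow from \<open>v\<close> to a point of the
  facet, so both are minimal on the facet.\<close>

lemma ray_face_of_normal_cone_iff:
  assumes v: "v \<in> P"
  shows "normal_cone P (Q i) face_of normal_cone P {v} \<longleftrightarrow> v \<in> Q i"
proof
  assume "normal_cone P (Q i) face_of normal_cone P {v}"
  then have "normal_cone P (Q i) \<subseteq> normal_cone P {v}" by (rule face_of_imp_subset)
  moreover have "U $ i \<in> normal_cone P (Q i)"
    by (auto simp: normal_cone_Q intro!: exI[of _ 1])
  moreover obtain x where "x \<in> Q i" using Q_nonempty by auto
  ultimately have "U $ i \<bullet> v \<le> U $ i \<bullet> x"
    using Q_subset[of i] unfolding normal_cone_def by blast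
  then have "U $ i \<bullet> v \<le> height i" using height_eq[OF \<open>x \<in> Q i\<close>] by simp
  then show "v \<in> Q i" using height_le[OF v, of i] v by (simp add: mem_Q_iff)
next
  assume vi: "v \<in> Q i"
  show "normal_cone P (Q i) face_of normal_cone P {v}"
    unfolding face_of_def
  proof (intro conjI ballI impI)
    show "normal_cone P (Q i) \<subseteq> normal_cone P {v}" using vi by (auto simp: normal_cone_def)
    have "normal_cone P F = (\<Inter>x\<in>F. \<Inter>y\<in>P. {u. (x - y) \<bullet> u \<le> 0})" for F
      by (auto simp: normal_cone_def inner_diff_right inner_commute[of "_ - _"])
    then show "convex (normal_cone P (Q i))"
      by (simp only:) (intro convex_INT convex_halfspace_le)
    fix a b x
    assume a: "a \<in> normal_cone P {v}" and b: "b \<in> normal_cone P {v}"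
      and x: "x \<in> normal_cone P (Q i)" "x \<in> open_segment a b"
    obtain t where t: "0 < t" "t < 1" "x = (1 - t) *\<^sub>R a + t *\<^sub>R b"
      using x(2) by (auto simp: in_segment)
    have eq: "a \<bullet> q = a \<bullet> v \<and> b \<bullet> q = b \<bullet> v" if q: "q \<in> Q i" for q
    proof -
      have "x \<bullet> q \<le> x \<bullet> v" using x(1) q v by (simp add: normal_cone_def)
      then have "(1 - t) * (a \<bullet> q - a \<bullet> v) + t * (b \<bullet> q - b \<bullet> v) \<le> 0"
        unfolding t(3) by (simp add: inner_add_left algebra_simps)
      moreover have "0 \<le> a \<bullet> q - a \<bullet> v" "0 \<le> b \<bullet> q - b \<bullet> v"
        using a b q Q_subset by (auto simp: normal_cone_def)
      ultimately have "(1 - t) * (a \<bullet> q - a \<bullet> v) = 0" "t * (b \<bullet> q - b \<bullet> v) = 0"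
        using t by (smt (verit) mult_nonneg_nonneg)+
      then show ?thesis using t by simp
    qed
    show "a \<in> normal_cone P (Q i)" "b \<in> normal_cone P (Q i)"
      using a b eq by (auto simp: normal_cone_def)
  qed
qed

lemma cone_rays_eq: "v \<in> P \<Longrightarrow> cone_rays P Q (normal_cone P {v}) = facets_at v"
  using ray_face_of_normal_cone_iff normal_cone_Q_ray
  by (simp add: cone_rays_def facets_at_def)

text \<open>The cone determines its rays, these are the facets at \<open>v\<close>, and they
  determine \<open>v\<close>.\<close>

lemma inj_on_normal_cone: "inj_on (\<lambda>v. normal_cone P {v}) {v. v extreme_point_of P}"
  by (rule inj_onI) (metis cone_rays_eq facets_at_inj mem_Collect_eq order_refl vertex_in_P)

text \<open>Two distinct points of a face confine its cone to the hyperplane orthogonal to their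
  difference. At a vertex, the cone contains the rows of all facets there, and only zero is
  orthogonal to these.\<close>

lemma maximal_cones:
  "fan_cones (normal_fan P) CARD('d) = (\<lambda>v. normal_cone P {v}) ` {v. v extreme_point_of P}"
proof (intro equalityI subsetI)
  fix N assume "N \<in> fan_cones (normal_fan P) CARD('d)"
  then obtain F where F: "N = normal_cone P F" "F face_of P" "F \<noteq> {}"
    and N: "aff_dim N = int CARD('d)"
    by (auto simp: fan_cones_def normal_fan_def)
  obtain v where v: "v \<in> F" using F(3) by auto
  have "F = {v}"
  proof (rule ccontr)
    assume "F \<noteq> {v}"
    then obtain w where w: "w \<in> F" "w \<noteq> v" using v by auto
    have "v \<in> P" "w \<in> P" using v w face_of_imp_subset[OF F(2)] by auto
    then have "N \<subseteq> {u. (w - v) \<bullet> u = 0}"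
      using v w unfolding F(1) normal_cone_def inner_commute[of "w - v"]
      by (auto simp: inner_diff_right intro: antisym)
    then have "aff_dim N \<le> aff_dim {u. (w - v) \<bullet> u = 0}" by (rule aff_dim_subset)
    then show False using N w by simp
  qed
  then show "N \<in> (\<lambda>v. normal_cone P {v}) ` {v. v extreme_point_of P}"
    using F by (auto simp: face_of_singleton)
next
  fix N assume "N \<in> (\<lambda>v. normal_cone P {v}) ` {v. v extreme_point_of P}"
  then obtain v where v: "v extreme_point_of P" and N: "N = normal_cone P {v}" by auto
  have UN: "U $ i \<in> N" if "i \<in> facets_at v" for i
    using that U_minimal by (auto simp: N normal_cone_def facets_at_def)
  have "\<not> dim N < DIM(real^'d)"
  proof
    assume "dim N < DIM(real^'d)"
    then obtain z where z: "z \<noteq> 0" "span N \<subseteq> {x. z \<bullet> x = 0}"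
      using lowdim_subset_hyperplane by blast
    have "U $ i \<bullet> z = 0" if "i \<in> facets_at v" for i
      using UN[OF that] span_base z(2) by (metis (mono_tags) inner_commute mem_Collect_eq subsetD)
    then show False using vertex_orthogonal[OF v] z(1) by blast
  qed
  then have "dim N = CARD('d)" using dim_subset_UNIV[of N] by simp
  moreover have "0 \<in> N" by (simp add: N normal_cone_def)
  ultimately have "aff_dim N = int CARD('d)" using aff_dim_zero[OF hull_inc, of N] by simp
  moreover have "N \<in> normal_fan P"
    using v by (auto simp: normal_fan_def N face_of_singleton)
  ultimately show "N \<in> fan_cones (normal_fan P) CARD('d)" by (simp add: fan_cones_def)
qed

section \<open>Vertex weights\<close>

abbreviation weight :: "real^'d \<Rightarrow> real" where
  "weight \<equiv> vertex_weight P Q U"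

text \<open>The kernel of the submatrix consists of vectors orthogonal to all rows at
  \<open>v\<close>, so the vertex criterion makes it trivial.\<close>

lemma weight_nonzero:
  assumes v: "v extreme_point_of P"
  shows "weight v \<noteq> 0"
proof -
  \<comment> \<open>The same choice as in \<open>abs_det_rows\<close>, so that its value is the
    determinant of \<open>?A\<close> up to sign.\<close>
  define b where "b = (SOME b. bij_betw b (UNIV :: 'd set) (facets_at v))"
  have "\<exists>b. bij_betw b (UNIV :: 'd set) (facets_at v)"
    using card_facets_at[OF v] by (intro finite_same_card_bij) auto
  then have b: "bij_betw b UNIV (facets_at v)" unfolding b_def by (rule someI_ex)
  let ?A = "(\<chi> i. U $ b i) :: real^'d^'d"
  have "z = 0" if "?A *v z = 0" for z
  proof (rule vertex_orthogonal[OF v])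
    fix i assume "i \<in> facets_at v"
    then obtain k where "i = b k" using b by (auto simp: bij_betw_def)
    then show "U $ i \<bullet> z = 0"
      using arg_cong[OF that, of "\<lambda>y. y $ k"] by (simp add: matrix_vector_mult_def inner_vec_def)
  qed
  then have "\<exists>B. B ** ?A = mat 1" using matrix_left_invertible_ker by blast
  then have "det ?A \<noteq> 0" by (simp add: invertible_left_inverse flip: invertible_det_nz)
  then show ?thesis
    using cone_rays_eq[OF vertex_in_P[OF v]]
    by (simp add: vertex_weight_def abs_det_rows_def Let_def flip: b_def)
qed

subsection \<open>The universal adjoint\<close>

text \<open>The common form of the adjoint and of all competing polynomials; uniqueness reduces to a
  comparison of the coefficients \<open>c\<close>.\<close>

definition vertex_sum :: "(real^'d \<Rightarrow> complex) \<Rightarrow> 'n cpoly" where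
  "vertex_sum c = (\<Sum>v | v extreme_point_of P.
     Poly_Mapping.single (sqfree_monomial (- facets_at v)) (c v))"

lemma universal_adjoint_eq: "universal_adjoint P Q U = vertex_sum (\<lambda>v. of_real (weight v))"
proof -
  have "universal_adjoint P Q U = (\<Sum>v | v extreme_point_of P.
      pconst (of_real (weight v)) * (\<Prod>i\<in>- cone_rays P Q (normal_cone P {v}). pvar i))"
    unfolding universal_adjoint_def maximal_cones
    by (subst sum.reindex[OF inj_on_normal_cone]) (simp add: vertex_weight_def)
  also have "\<dots> = vertex_sum (\<lambda>v. of_real (weight v))"
    unfolding vertex_sum_def
    by (rule sum.cong)
      (auto simp: cone_rays_eq vertex_in_P prod_pvar pconst_times_single)
  finally show ?thesis .
qed

lemma pconst_times_vertex_sum: "pconst a * vertex_sum c = vertex_sum (\<lambda>v. a * c v)"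
  by (simp add: vertex_sum_def sum_distrib_left pconst_times_single)

text \<open>Distinct vertices have distinct facet sets, hence distinct monomials, so no terms merge
  or cancel.\<close>

lemma lookup_vertex_sum:
  assumes "v extreme_point_of P"
  shows "Poly_Mapping.lookup (vertex_sum c) (sqfree_monomial (- facets_at v)) = c v"
proof -
  have "Poly_Mapping.lookup (vertex_sum c) (sqfree_monomial (- facets_at v)) =
      (\<Sum>w | w extreme_point_of P. if w = v then c w else 0)"
    unfolding vertex_sum_def lookup_sum
    by (rule sum.cong)
      (use assms facets_at_inj in \<open>auto simp: lookup_single when_def sqfree_monomial_inject\<close>)
  also have "\<dots> = c v" using assms finite_vertices by simp
  finally show ?thesis .
qed

lemma keys_vertex_sum:
  "Poly_Mapping.keys (vertex_sum c) \<subseteq> (\<lambda>v. sqfree_monomial (- facets_at v)) ` {v. v extreme_point_of P}"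
proof
  fix m assume "m \<in> Poly_Mapping.keys (vertex_sum c)"
  then have "(\<Sum>v | v extreme_point_of P.
      Poly_Mapping.lookup (Poly_Mapping.single (sqfree_monomial (- facets_at v)) (c v)) m) \<noteq> 0"
    by (simp add: in_keys_iff vertex_sum_def lookup_sum)
  then obtain v where "v extreme_point_of P"
      "Poly_Mapping.lookup (Poly_Mapping.single (sqfree_monomial (- facets_at v)) (c v)) m \<noteq> 0"
    by (rule sum.not_neutral_contains_not_neutral) auto
  then show "m \<in> (\<lambda>v. sqfree_monomial (- facets_at v)) ` {v. v extreme_point_of P}"
    by (auto simp: lookup_single when_def split: if_splits)
qed

lemma eq_vertex_sum:
  assumes "Poly_Mapping.keys f \<subseteq> (\<lambda>v. sqfree_monomial (- facets_at v)) ` {v. v extreme_point_of P}"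
  shows "f = vertex_sum (\<lambda>v. Poly_Mapping.lookup f (sqfree_monomial (- facets_at v)))"
    (is "f = ?g")
proof (rule poly_mapping_eqI)
  fix m
  show "Poly_Mapping.lookup f m = Poly_Mapping.lookup ?g m"
  proof (cases "m \<in> (\<lambda>v. sqfree_monomial (- facets_at v)) ` {v. v extreme_point_of P}")
    case True
    then show ?thesis using lookup_vertex_sum by auto
  next
    case False
    then have "m \<notin> Poly_Mapping.keys f" "m \<notin> Poly_Mapping.keys ?g"
      using assms keys_vertex_sum by blast+
    then show ?thesis by (simp add: in_keys_iff)
  qed
qed

lemma peval_vertex_sum:
  "peval (vertex_sum c) x = (\<Sum>v | v extreme_point_of P. c v * (\<Prod>i\<in>- facets_at v. x $ i))"
  by (simp add: vertex_sum_def peval_sum peval_single prod_power_sqfree_monomial)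

lemma homogeneous_vertex_sum: "homogeneous (CARD('n) - CARD('d)) (vertex_sum c)"
  unfolding homogeneous_def
proof
  fix m assume "m \<in> Poly_Mapping.keys (vertex_sum c)"
  then obtain v where v: "v extreme_point_of P" "m = sqfree_monomial (- facets_at v)"
    using keys_vertex_sum by blast
  have "(\<Sum>i\<in>UNIV. Poly_Mapping.lookup m i) = card (- facets_at v)"
    unfolding v(2) lookup_sqfree_monomial by (simp add: sum.If_cases Compl_eq)
  then show "(\<Sum>i\<in>UNIV. Poly_Mapping.lookup m i) = CARD('n) - CARD('d)"
    using card_facets_at[OF v(1)] by (simp add: Compl_eq_Diff_UNIV card_Diff_subset)
qed

text \<open>The other end of an edge at \<open>v\<close> lies on a facet that misses
  \<open>v\<close>, so there are more facets than the \<open>CARD('d)\<close> at \<open>v\<close>.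
  This makes the degree of the adjoint positive.\<close>

lemma card_less: "CARD('d) < CARD('n)"
proof -
  obtain v where v: "v extreme_point_of P" using vertex_exists by blast
  have "card (facets_at v) > 0" using card_facets_at[OF v] by simp
  then obtain j where j: "j \<in> facets_at v" by (auto simp: card_gt_0_iff)
  obtain z where "U $ j \<bullet> z = 1" "\<And>i. i \<in> facets_at v - {j} \<Longrightarrow> U $ i \<bullet> z = 0"
    using ex_dual_vector[OF v j] by blast
  then obtain w where w: "w extreme_point_of P" "w \<noteq> v"
    using edge_from_vertex[OF v j, of z] by (metis add_cancel_left_right inner_zero_right less_irrefl
        scaleR_eq_0_iff zero_neq_one)
  then obtain i where "i \<in> facets_at w" "i \<notin> facets_at v"
    using facets_at_inj[OF w(1) v] by auto
  then have "facets_at v \<subset> UNIV" by blast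
  then have "card (facets_at v) < CARD('n)" by (rule psubset_card_mono[rotated]) simp
  then show ?thesis using card_facets_at[OF v] by simp
qed

section \<open>Vanishing on the planes of primitive collections and edges\<close>

lemma vertex_sum_cong:
  "(\<And>v. v extreme_point_of P \<Longrightarrow> c v = c' v) \<Longrightarrow> vertex_sum c = vertex_sum c'"
  unfolding vertex_sum_def by (rule sum.cong) auto

text \<open>Every vertex misses some facet of \<open>J\<close>, and the variable of that facet
  divides the term of the vertex.\<close>

lemma vertex_sum_vanishes:
  assumes "J \<in> noncones Q" "\<And>i. i \<in> J \<Longrightarrow> x $ i = 0"
  shows "peval (vertex_sum c) x = 0"
  unfolding peval_vertex_sum
proof (rule sum.neutral, rule ballI)
  fix v
  have "\<exists>i\<in>J. v \<notin> Q i" using assms(1) by (auto simp: noncones_def)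
  then obtain i where "i \<in> J" "i \<in> - facets_at v" by (auto simp: facets_at_def)
  then have "(\<Prod>i\<in>- facets_at v. x $ i) = 0" using assms(2) by (intro prod_zero) auto
  then show "c v * (\<Prod>i\<in>- facets_at v. x $ i) = 0" by simp
qed

lemma primitive_planes_vertex_sum: "contains_primitive_planes Q (proj_zeros (vertex_sum c))"
  unfolding contains_primitive_planes_def
proof (intro allI impI)
  fix J assume "primitive_collection Q J"
  then have J: "J \<in> noncones Q" by (simp add: primitive_collection_def)
  have "card J \<le> CARD('n)" by (rule card_mono) auto
  then show "coord_plane J \<in> fano (int CARD('n) - 1 - int (card J)) (proj_zeros (vertex_sum c))"
    using vertex_sum_vanishes[OF J]
    by (intro fanoI[OF coord_plane_eq subspace_coord]) (auto simp: dim_coord of_nat_diff)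
qed

lemma edge_facets:
  assumes e: "closed_segment v w edge_of P" and vw: "v \<noteq> w"
    and v: "v extreme_point_of P" and w: "w extreme_point_of P"
  obtains a b I where "facets_at v = insert a I" "facets_at w = insert b I"
    "a \<notin> I" "b \<notin> I" "a \<noteq> b"
    "end_facet Q (closed_segment v w) v = a" "end_facet Q (closed_segment v w) w = b"
    "{i. closed_segment v w \<subseteq> Q i} = I"
proof -
  have P: "v \<in> P" "w \<in> P" using v w by (auto dest: vertex_in_P)
  have e': "closed_segment w v edge_of P" using e by (simp add: closed_segment_commute)
  obtain a where a: "facets_at v - facets_at w = {a}"
    using facets_at_diff_singleton[OF e vw v] by blast
  obtain b where b: "facets_at w - facets_at v = {b}"
    using facets_at_diff_singleton[OF e' vw[symmetric] w] by blast
  show thesis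
    by (rule that[of a "facets_at v \<inter> facets_at w" b])
      (use a b end_facet_eq[OF P a] end_facet_eq[OF P(2,1) b] facets_containing_segment[OF P]
        in \<open>auto simp: closed_segment_commute\<close>)
qed

text \<open>A vertex other than \<open>v\<close> and \<open>w\<close> misses a facet of
  \<open>I\<close>, so its term vanishes. The monomials of \<open>v\<close> and \<open>w\<close>
  differ only in the factors \<open>x $ b\<close> and \<open>x $ a\<close>.\<close>

lemma peval_vertex_sum_edge:
  assumes e: "closed_segment v w edge_of P" and vw: "v \<noteq> w"
    and v: "v extreme_point_of P" and w: "w extreme_point_of P"
    and I: "facets_at v = insert a I" "facets_at w = insert b I" "a \<notin> I" "b \<notin> I" "a \<noteq> b"
    and x: "\<And>i. i \<in> I \<Longrightarrow> x $ i = 0"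
  shows "peval (vertex_sum c) x =
    (c v * x $ b + c w * x $ a) * (\<Prod>i\<in>- insert a (insert b I). x $ i)"
proof -
  let ?t = "\<lambda>u. c u * (\<Prod>i\<in>- facets_at u. x $ i)"
  have "peval (vertex_sum c) x = sum ?t {v, w}"
    unfolding peval_vertex_sum
  proof (rule sum.mono_neutral_right)
    show "\<forall>u\<in>{u. u extreme_point_of P} - {v, w}. ?t u = 0"
    proof
      fix u assume u: "u \<in> {u. u extreme_point_of P} - {v, w}"
      then have "\<not> facets_at v \<inter> facets_at w \<subseteq> facets_at u"
        using edge_vertices[OF e vw v w, of u] by blast
      moreover have "facets_at v \<inter> facets_at w = I" using I by auto
      ultimately obtain i where "i \<in> I" "i \<in> - facets_at u" by blast
      then have "(\<Prod>i\<in>- facets_at u. x $ i) = 0" using x by (intro prod_zero) auto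
      then show "?t u = 0" by simp
    qed
  qed (use finite_vertices v w in auto)
  moreover have "- facets_at v = insert b (- insert a (insert b I))"
    "- facets_at w = insert a (- insert a (insert b I))" using I by auto
  ultimately show ?thesis using vw by (simp add: algebra_simps)
qed

lemma edge_section_eq:
  assumes "{i. e \<subseteq> Q i} = I" "end_facet Q e v = a" "end_facet Q e w = b"
  shows "edge_plane Q e \<inter> edge_hyperplane P Q U e v w =
    {L \<in> proj_space. L \<subseteq>
      {x. (\<forall>i\<in>I. x $ i = 0) \<and> of_real (weight v) * x $ b + of_real (weight w) * x $ a = 0}}"
  using assms by (auto simp: edge_plane_def edge_hyperplane_def coord_plane_def)

text \<open>Restricted to the plane of the edge, the adjoint is the linear form of the hyperplane
  times a monomial.\<close>

lemma edge_planes_universal_adjoint: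
  "contains_edge_planes P Q U (proj_zeros (universal_adjoint P Q U))"
  unfolding contains_edge_planes_def
proof (intro allI impI, elim conjE)
  fix e v w
  assume e: "e edge_of P" "{z. z extreme_point_of e} = {v, w}" and vw: "v \<noteq> w"
  note seg = edge_segment[OF e]
  have edge: "closed_segment v w edge_of P" using e(1) seg(1) by simp
  obtain a b I where I: "facets_at v = insert a I" "facets_at w = insert b I"
    "a \<notin> I" "b \<notin> I" "a \<noteq> b"
    and ends: "end_facet Q e v = a" "end_facet Q e w = b" "{i. e \<subseteq> Q i} = I"
    by (rule edge_facets[OF edge vw seg(2,3), folded seg(1)]) (rule that)
  \<comment> \<open>The weight of \<open>w\<close> is nonzero, so the equation cuts the dimension by
    one; \<open>insert a I\<close> is the set of facets at \<open>v\<close>.\<close>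
  have dim: "vec.dim {x :: complex^'n. (\<forall>i\<in>I. x $ i = 0) \<and>
      of_real (weight v) * x $ b + of_real (weight w) * x $ a = 0} = CARD('n) - CARD('d)"
    using dim_coord_hyperplane[of "of_real (weight w)" a I b "of_real (weight v)"]
      weight_nonzero[OF seg(3)] I card_facets_at[OF seg(2)] by simp
  show "edge_plane Q e \<inter> edge_hyperplane P Q U e v w
      \<in> fano (int CARD('n) - int CARD('d) - 1) (proj_zeros (universal_adjoint P Q U))"
  proof (rule fanoI[OF edge_section_eq[OF ends(3,1,2)] subspace_coord_hyperplane])
    fix x :: "complex^'n"
    assume "x \<in> {x. (\<forall>i\<in>I. x $ i = 0) \<and>
      of_real (weight v) * x $ b + of_real (weight w) * x $ a = 0}"
    then show "peval (universal_adjoint P Q U) x = 0"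
      using peval_vertex_sum_edge[OF edge vw seg(2,3) I, of x] by (simp add: universal_adjoint_eq)
  qed (use dim card_less in simp)
qed

section \<open>Uniqueness\<close>

lemma keys_subset:
  assumes hom: "homogeneous (CARD('n) - CARD('d)) f"
    and planes: "contains_primitive_planes Q (proj_zeros f)"
  shows "Poly_Mapping.keys f \<subseteq> (\<lambda>v. sqfree_monomial (- facets_at v)) ` {v. v extreme_point_of P}"
proof
  fix m assume m: "m \<in> Poly_Mapping.keys f"
  define S where "S = {i. Poly_Mapping.lookup m i = 0}"
  have "S \<notin> noncones Q"
  proof
    assume "S \<in> noncones Q"
    \<comment> \<open>Among the finitely many noncones inside \<open>S\<close>, a minimal one is a
      primitive collection.\<close>
    then obtain J where J: "J \<in> noncones Q" "J \<subseteq> S" "\<And>K. K \<in> noncones Q \<Longrightarrow> K \<subseteq> J \<Longrightarrow> J = K"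
      using finite_has_minimal2[of "noncones Q" S] by auto
    then have "primitive_collection Q J" by (auto simp: primitive_collection_def)
    then have sub: "coord_plane J \<subseteq> proj_zeros f"
      using planes by (auto simp: contains_primitive_planes_def fano_def)
    have "peval f x = 0" if "\<And>i. i \<in> J \<Longrightarrow> x $ i = 0" for x
    proof (cases "x = 0")
      case True
      then show ?thesis using peval_at_0[OF hom] card_less by simp
    next
      case False
      then show ?thesis
        using peval_eq_0_if_plane_subset[OF sub[unfolded coord_plane_eq] subspace_coord] that by blast
    qed
    then have "Poly_Mapping.lookup f m = 0"
      by (rule coefficient_eq_0) (use J(2) in \<open>auto simp: S_def\<close>)
    then show False using m by (simp add: in_keys_iff)
  qed
  then obtain x where x: "\<And>i. i \<in> S \<Longrightarrow> x \<in> Q i" by (auto simp: noncones_def)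
  \<comment> \<open>For empty \<open>S\<close> the intersection of the facets is the whole space and
    \<open>x\<close> may lie outside \<open>P\<close>; any vertex serves then.\<close>
  have "\<exists>x\<in>P. S \<subseteq> facets_at x"
  proof (cases "S = {}")
    case True
    then show ?thesis using vertex_exists vertex_in_P by auto
  next
    case False
    then have "x \<in> P" using x Q_subset by blast
    then show ?thesis using x by (auto simp: facets_at_def)
  qed
  then obtain v where v: "v extreme_point_of P" "S \<subseteq> facets_at v" using ex_vertex by blast
  have "m = sqfree_monomial (- facets_at v)"
  proof (rule eq_sqfree_monomial)
    have "card (- facets_at v) = CARD('n) - CARD('d)"
      using card_facets_at[OF v(1)] by (simp add: Compl_eq_Diff_UNIV card_Diff_subset)
    then show "(\<Sum>i\<in>UNIV. Poly_Mapping.lookup m i) \<le> card (- facets_at v)"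
      using hom m by (simp add: homogeneous_def)
  qed (use v(2) in \<open>auto simp: S_def\<close>)
  then show "m \<in> (\<lambda>v. sqfree_monomial (- facets_at v)) ` {v. v extreme_point_of P}"
    using v(1) by blast
qed

lemma edge_relation:
  assumes planes: "contains_edge_planes P Q U (proj_zeros (vertex_sum c))"
    and edge: "closed_segment v w edge_of P" and vw: "v \<noteq> w"
    and v: "v extreme_point_of P" and w: "w extreme_point_of P"
  shows "c v * of_real (weight w) = c w * of_real (weight v)"
proof -
  let ?e = "closed_segment v w"
  obtain a b I where I: "facets_at v = insert a I" "facets_at w = insert b I"
    "a \<notin> I" "b \<notin> I" "a \<noteq> b"
    and ends: "end_facet Q ?e v = a" "end_facet Q ?e w = b" "{i. ?e \<subseteq> Q i} = I"
    by (rule edge_facets[OF edge vw v w]) (rule that)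
  have "{z. z extreme_point_of ?e} = {v, w}" by (auto simp: extreme_point_of_segment)
  then have "edge_plane Q ?e \<inter> edge_hyperplane P Q U ?e v w
      \<in> fano (int CARD('n) - int CARD('d) - 1) (proj_zeros (vertex_sum c))"
    using planes edge vw unfolding contains_edge_planes_def by blast
  then have sub: "{L \<in> proj_space. L \<subseteq> {x. (\<forall>i\<in>I. x $ i = 0) \<and>
      of_real (weight v) * x $ b + of_real (weight w) * x $ a = 0}} \<subseteq> proj_zeros (vertex_sum c)"
    unfolding edge_section_eq[OF ends(3,1,2)] fano_def by blast
  \<comment> \<open>A point of the section: the values at \<open>b\<close> and \<open>a\<close>
    solve the equation of the hyperplane, and the ones elsewhere make the remaining monomial equal
    to 1.\<close>
  define x :: "complex^'n" where
    "x = (\<chi> i. if i \<in> I then 0 else if i = b then of_real (weight w)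
      else if i = a then - of_real (weight v) else 1)"
  have xI: "x $ i = 0" if "i \<in> I" for i using that by (simp add: x_def)
  have xb: "x $ b = of_real (weight w)" and xa: "x $ a = - of_real (weight v)"
    using I by (auto simp: x_def)
  have "x \<noteq> 0" using xb weight_nonzero[OF w] by auto
  then have "peval (vertex_sum c) x = 0"
    by (intro peval_eq_0_if_plane_subset[OF sub subspace_coord_hyperplane]) (auto simp: xI xa xb)
  moreover have "(\<Prod>i\<in>- insert a (insert b I). x $ i) = 1"
    by (rule prod.neutral) (simp add: x_def)
  ultimately show ?thesis
    using peval_vertex_sum_edge[OF edge vw v w I xI, of c] xa xb by simp
qed

lemma universal_adjoint_unique:
  assumes "f \<noteq> 0" and hom: "homogeneous (CARD('n) - CARD('d)) f"
    and primitive: "contains_primitive_planes Q (proj_zeros f)"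
    and edges: "contains_edge_planes P Q U (proj_zeros f)"
  shows "\<exists>c. c \<noteq> 0 \<and> f = pconst c * universal_adjoint P Q U"
proof -
  obtain c where f: "f = vertex_sum c" using eq_vertex_sum[OF keys_subset[OF hom primitive]] ..
  obtain v0 where v0: "v0 extreme_point_of P" using vertex_exists by blast
  \<comment> \<open>The scalar is read off at one vertex; the edge relations carry it to all
    others.\<close>
  let ?r = "c v0 / of_real (weight v0)"
  have "c v = ?r * of_real (weight v)" if "v extreme_point_of P" for v
  proof (rule vertex_connected[OF that v0])
    show "c v0 = ?r * of_real (weight v0)" using weight_nonzero[OF v0] by simp
    fix v w
    assume v: "v extreme_point_of P" and w: "w extreme_point_of P" and vw: "v \<noteq> w"
      and edge: "closed_segment v w edge_of P" and cw: "c w = ?r * of_real (weight w)"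
    have "c v * of_real (weight w) = ?r * of_real (weight v) * of_real (weight w)"
      using edge_relation[OF edges[unfolded f] edge vw v w] cw by (simp add: mult_ac)
    then show "c v = ?r * of_real (weight v)"
      using weight_nonzero[OF w] by (metis mult_right_cancel of_real_eq_0_iff)
  qed
  then have eq: "f = pconst ?r * universal_adjoint P Q U"
    unfolding f universal_adjoint_eq pconst_times_vertex_sum by (rule vertex_sum_cong)
  then have "?r \<noteq> 0" using assms(1) by (auto simp: pconst_def)
  then show ?thesis using eq by blast
qed

lemma universal_adjoint_nonzero: "universal_adjoint P Q U \<noteq> 0"
proof
  assume 0: "universal_adjoint P Q U = 0"
  obtain v where v: "v extreme_point_of P" using vertex_exists by blast
  show False
    using lookup_vertex_sum[OF v, of "\<lambda>v. of_real (weight v)"] 0 weight_nonzero[OF v]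
    by (simp flip: universal_adjoint_eq)
qed

end

theorem theorem5p6:
  fixes P :: "(real^'d) set"
    and Q :: "'n::finite \<Rightarrow> (real^'d) set"
    and U :: "real^'d^'n"
  assumes "simple_polytope P"
    and "facet_labelling P Q"
    and "ray_matrix P Q U"
  shows "universal_adjoint P Q U \<noteq> 0
    \<and> homogeneous (CARD('n) - CARD('d)) (universal_adjoint P Q U)
    \<and> contains_primitive_planes Q (proj_zeros (universal_adjoint P Q U))
    \<and> contains_edge_planes P Q U (proj_zeros (universal_adjoint P Q U))
    \<and> (\<forall>f :: 'n cpoly.
          f \<noteq> 0 \<and> homogeneous (CARD('n) - CARD('d)) f
          \<and> contains_primitive_planes Q (proj_zeros f)
          \<and> contains_edge_planes P Q U (proj_zeros f)
          \<longrightarrow> (\<exists>c. c \<noteq> 0 \<and> f = pconst c * universal_adjoint P Q U))"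
proof -
  interpret labelled_simple_polytope P Q U
    using assms by unfold_locales
  show ?thesis
    using universal_adjoint_nonzero homogeneous_vertex_sum primitive_planes_vertex_sum
      edge_planes_universal_adjoint universal_adjoint_unique
    by (simp add: universal_adjoint_eq)
qed

end
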